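(* Let $\Gamma$ be a finitely generated group, $p$ a prime number and $\overline{\rho}$ a non-trivial morphism in $\mathrm{Hom}(\Gamma,\langle\overline{M_c}\rangle)$. Then the restriction $\varphi_{|\overline{\mathcal{H}_{\overline{\rho}}}^i}:\overline{\mathcal{H}_{\overline{\rho}}}^i\to\chi^i(\Gamma,PSL(p,\mathbb{C}))$ is a homeomorphism onto its image.
   Context: Let $\xi\in\mathbb{C}$ be a primitive $p$-th root of unity. For $M\in SL(p,\mathbb{C})$, $\overline{M}$ denotes its image in $PSL(p,\mathbb{C})$. Rows and columns are indexed by $\mathbb{Z}/p=\{0,\dots,p-1\}$, with canonical basis $(e_i)$. $D\subset SL(p,\mathbb{C})$ is the subgroup of diagonal matrices and $\overline{D}$ its image in $PSL(p,\mathbb{C})$. For $p$ odd, $M_c$ is the permutation matrix of the cycle $(0,1,\dots,p-1)$, i.e. $M_ce_i=e_{i+1}$; for $p=2$, $M_c=\begin{pmatrix}0&\sqrt{-1}\\\sqrt{-1}&0\end{pmatrix}$. The element $\overline{M_c}$ has order $p$, normalizes $\overline{D}$ and $\overline{D}\cap\langle\overline{M_c}\rangle$ is trivial, so $\overline{D}\rtimes\langle\overline{M_c}\rangle$ is a subgroup of $PSL(p,\mathbb{C})$; $q:\overline{D}\rtimes\langle\overline{M_c}\rangle\to\langle\overline{M_c}\rangle$ is the natural projection. A subgroup of $PSL(p,\mathbb{C})$ is irreducible if it is not contained in any (proper) parabolic subgroup; a representation is irreducible if its image is. For a group $G\leq PSL(p,\mathbb{C})$, $\mathrm{Hom}(\Gamma,G)$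 has the topology induced by the usual (transcendental) topology of $G$ via $\mathrm{Hom}(\Gamma,G)\subset G^r$, where $\Gamma$ is generated by $r$ elements. $\mathrm{Hom}^i(\Gamma,PSL(p,\mathbb{C}))$ is the set of irreducible representations and $\chi^i(\Gamma,PSL(p,\mathbb{C}))$ its quotient by conjugation by $PSL(p,\mathbb{C})$. $\mathrm{Hom}^i(\Gamma,\overline{D}\rtimes\langle\overline{M_c}\rangle)$ is the set of irreducible representations into $PSL(p,\mathbb{C})$ with image in $\overline{D}\rtimes\langle\overline{M_c}\rangle$, and $\chi^i(\Gamma,\overline{D}\rtimes\langle\overline{M_c}\rangle)$ is its quotient by conjugation by $\overline{D}\rtimes\langle\overline{M_c}\rangle$. Quotients carry the quotient topology. The map $\varphi:\chi^i(\Gamma,\overline{D}\rtimes\langle\overline{M_c}\rangle)\to\chi^i(\Gamma,PSL(p,\mathbb{C}))$ is induced by the inclusion. For $\overline{\rho}\in\mathrm{Hom}(\Gamma,\langle\overline{M_c}\rangle)$, $\mathcal{H}_{\overline{\rho}}^i:=\{\rho\in\mathrm{Hom}^i(\Gamma,\overline{D}\rtimes\langle\overline{M_c}\rangle)\mid q\circ\rho=\overline{\rho}\}$ and $\overline{\mathcal{H}_{\overline{\rho}}}^i$ is its image in $\chi^i(\Gamma,\overline{D}\rtimes\langle\overline{M_c}\rangle)$. *)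

theory Defs
  imports
    "HOL-Analysis.Analysis"
    "HOL-Algebra.Coset"
    "HOL-Algebra.Generated_Groups"
    "Berlekamp_Zassenhaus.Finite_Field"
begin

section \<open>Quotient topologies\<close>

definition quotient_topology :: "'a topology \<Rightarrow> ('a \<Rightarrow> 'b) \<Rightarrow> 'b topology" where
  "quotient_topology T f =
     topology (\<lambda>U. U \<subseteq> f ` topspace T \<and> openin T {x \<in> topspace T. f x \<in> U})"

lemma istopology_quotient:
  "istopology (\<lambda>U. U \<subseteq> f ` topspace T \<and> openin T {x \<in> topspace T. f x \<in> U})"
  unfolding istopology_def
proof (intro conjI allI impI)
  fix S S'
  assume "S \<subseteq> f ` topspace T \<and> openin T {x \<in> topspace T. f x \<in> S}"
    and "S' \<subseteq> f ` topspace T \<and> openin T {x \<in> topspace T. f x \<in> S'}"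
  moreover have "{x \<in> topspace T. f x \<in> S \<inter> S'}
      = {x \<in> topspace T. f x \<in> S} \<inter> {x \<in> topspace T. f x \<in> S'}" by auto
  ultimately show "S \<inter> S' \<subseteq> f ` topspace T" "openin T {x \<in> topspace T. f x \<in> S \<inter> S'}"
    by auto
next
  fix \<K>
  assume "\<forall>K\<in>\<K>. K \<subseteq> f ` topspace T \<and> openin T {x \<in> topspace T. f x \<in> K}"
  moreover have "{x \<in> topspace T. f x \<in> \<Union>\<K>} = (\<Union>K\<in>\<K>. {x \<in> topspace T. f x \<in> K})" by auto
  ultimately show "\<Union>\<K> \<subseteq> f ` topspace T" "openin T {x \<in> topspace T. f x \<in> \<Union>\<K>}"
    by auto
qed

lemma openin_quotient_topology:
  "openin (quotient_topology T f) U \<longleftrightarrow>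
     U \<subseteq> f ` topspace T \<and> openin T {x \<in> topspace T. f x \<in> U}"
  unfolding quotient_topology_def topology_inverse'[OF istopology_quotient] ..

lemma topspace_quotient_topology: "topspace (quotient_topology T f) = f ` topspace T"
proof
  show "topspace (quotient_topology T f) \<subseteq> f ` topspace T"
    using openin_topspace[of "quotient_topology T f"] by (simp only: openin_quotient_topology)
  have "{x \<in> topspace T. f x \<in> f ` topspace T} = topspace T" by auto
  then show "f ` topspace T \<subseteq> topspace (quotient_topology T f)"
    by (intro openin_subset) (simp add: openin_quotient_topology)
qed

lemma quotient_map_quotient_topology: "quotient_map T (quotient_topology T f) f"
  by (simp add: quotient_map_def topspace_quotient_topology openin_quotient_topology)

section \<open>The topological group $PSL(n,\mathbb{C})$\<close>

definition SL :: "(complex^'n^'n) monoid" where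
  "SL = \<lparr>carrier = {A. det A = 1}, mult = (**), one = mat 1\<rparr>"

definition group_center :: "('a, 'b) monoid_scheme \<Rightarrow> 'a set" where
  "group_center G = {z \<in> carrier G. \<forall>g\<in>carrier G. z \<otimes>\<^bsub>G\<^esub> g = g \<otimes>\<^bsub>G\<^esub> z}"

definition PSL :: "(complex^'n^'n) set monoid" where
  "PSL = SL Mod group_center SL"

definition psl_proj :: "complex^'n^'n \<Rightarrow> (complex^'n^'n) set" where
  "psl_proj A = group_center SL #>\<^bsub>SL\<^esub> A"

definition PSL_top :: "(complex^'n^'n) set topology" where
  "PSL_top = quotient_topology (subtopology euclidean (carrier SL)) psl_proj"

lemma group_SL: "group (SL :: (complex^'n^'n) monoid)"
proof (rule groupI)
  fix A :: "complex^'n^'n"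
  assume "A \<in> carrier SL"
  then have A: "det A = 1" by (simp add: SL_def)
  then have "invertible A" by (simp add: invertible_det_nz)
  then obtain B where AB: "A ** B = mat 1" "B ** A = mat 1"
    unfolding invertible_def by blast
  have "det A * det B = 1" using arg_cong[OF AB(1), of det] by (simp add: det_mul)
  with A have "B \<in> carrier SL" by (simp add: SL_def)
  moreover have "B \<otimes>\<^bsub>SL\<^esub> A = \<one>\<^bsub>SL\<^esub>" using AB(2) by (simp add: SL_def)
  ultimately show "\<exists>B\<in>carrier SL. B \<otimes>\<^bsub>SL\<^esub> A = \<one>\<^bsub>SL\<^esub>" by blast
qed (simp_all add: SL_def det_mul matrix_mul_assoc)

lemma (in group) normal_group_center: "group_center G \<lhd> G"
proof (rule normal_invI)
  have closed: "a \<in> carrier G" and comm: "\<And>g. g \<in> carrier G \<Longrightarrow> a \<otimes> g = g \<otimes> a"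
    if "a \<in> group_center G" for a
    using that unfolding group_center_def by blast+
  have centerI: "a \<in> group_center G"
    if "a \<in> carrier G" "\<And>g. g \<in> carrier G \<Longrightarrow> a \<otimes> g = g \<otimes> a" for a
    using that unfolding group_center_def by blast
  show "subgroup (group_center G) G"
  proof (rule subgroupI)
    show "group_center G \<subseteq> carrier G" using closed by blast
    have "\<one> \<in> group_center G" by (rule centerI) simp_all
    then show "group_center G \<noteq> {}" by blast
  next
    fix a assume a: "a \<in> group_center G"
    show "inv a \<in> group_center G"
    proof (rule centerI)
      fix g assume g: "g \<in> carrier G"
      have "inv a \<otimes> g = inv (inv g \<otimes> a)" using closed[OF a] g by (simp add: inv_mult_group)
      also have "\<dots> = inv (a \<otimes> inv g)" using comm[OF a, of "inv g"] g by (simp only: inv_closed)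
      also have "\<dots> = g \<otimes> inv a" using closed[OF a] g by (simp add: inv_mult_group)
      finally show "inv a \<otimes> g = g \<otimes> inv a" .
    qed (use closed[OF a] in simp)
  next
    fix a b assume a: "a \<in> group_center G" and b: "b \<in> group_center G"
    note c = closed[OF a] closed[OF b]
    show "a \<otimes> b \<in> group_center G"
    proof (rule centerI)
      fix g assume g: "g \<in> carrier G"
      have "a \<otimes> b \<otimes> g = a \<otimes> (b \<otimes> g)" by (rule m_assoc[OF c g])
      also have "b \<otimes> g = g \<otimes> b" by (rule comm[OF b g])
      also have "a \<otimes> (g \<otimes> b) = a \<otimes> g \<otimes> b" by (rule m_assoc[symmetric, OF c(1) g c(2)])
      also have "a \<otimes> g = g \<otimes> a" by (rule comm[OF a g])
      also have "g \<otimes> a \<otimes> b = g \<otimes> (a \<otimes> b)" by (rule m_assoc[OF g c])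
      finally show "a \<otimes> b \<otimes> g = g \<otimes> (a \<otimes> b)" .
    qed (use c in simp)
  qed
  fix x h assume x: "x \<in> carrier G" and h: "h \<in> group_center G"
  have "x \<otimes> h \<otimes> inv x = h \<otimes> x \<otimes> inv x" by (simp only: comm[OF h x])
  also have "\<dots> = h" using closed[OF h] x by (simp add: m_assoc)
  finally show "x \<otimes> h \<otimes> inv x \<in> group_center G" using h by (simp only:)
qed

lemma group_PSL: "group (PSL :: (complex^'n^'n) set monoid)"
  unfolding PSL_def
  by (rule normal.factorgroup_is_group[OF group.normal_group_center[OF group_SL]])

lemma psl_proj_hom: "psl_proj \<in> hom SL (PSL :: (complex^'n^'n) set monoid)"
  unfolding PSL_def psl_proj_def
  by (rule normal.r_coset_hom_Mod[OF group.normal_group_center[OF group_SL]])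

lemma topspace_PSL_top: "topspace PSL_top = carrier (PSL :: (complex^'n^'n) set monoid)"
  by (simp add: PSL_top_def topspace_quotient_topology PSL_def carrier_FactGroup psl_proj_def)

section \<open>Parabolic and irreducible subgroups\<close>

text \<open>
  The parabolic subgroups of $PSL(n,\mathbb{C})$ are the stabilizers of flags of
  complex subspaces of $\mathbb{C}^n$.
\<close>

definition parabolic :: "(complex^'n^'n) set set \<Rightarrow> bool" where
  "parabolic P \<longleftrightarrow>
     (\<exists>F. (\<forall>V\<in>F. vec.subspace V) \<and> chain_subset F \<and>
          P = psl_proj ` {A \<in> carrier SL. \<forall>V\<in>F. (*v) A ` V = V})"

definition irreducible_subgroup :: "(complex^'n^'n) set set \<Rightarrow> bool" where
  "irreducible_subgroup H \<longleftrightarrow> \<not> (\<exists>P. parabolic P \<and> P \<noteq> carrier PSL \<and> H \<subseteq> P)"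

section \<open>The subgroup $\overline{D}\rtimes\langle\overline{M_c}\rangle$\<close>

text \<open>
  Below \<open>'p mod_ring\<close> is $\mathbb{Z}/p$ for the prime \<open>p = CARD('p)\<close>. The matrix \<open>M_c\<close> sends
  $e_j$ to $e_{j+1}$; for \<open>p = 2\<close> the factor \<open>\<i>\<close> makes its determinant 1.
\<close>

definition Dbar :: "(complex^'n^'n) set set" where
  "Dbar = psl_proj ` {A \<in> carrier SL. \<forall>i j. i \<noteq> j \<longrightarrow> A $ i $ j = 0}"

definition M_c :: "complex^('p::prime_card mod_ring)^('p mod_ring)" where
  "M_c = (\<chi> i j. if i = j + 1 then (if CARD('p) = 2 then \<i> else 1) else 0)"

lemma M_c_in_SL: "M_c \<in> carrier (SL :: (complex^('p::prime_card mod_ring)^('p mod_ring)) monoid)"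
proof -
  let ?s = "\<lambda>i::'p mod_ring. i - 1"
  let ?P = "(\<chi> i. (mat 1 :: complex^('p mod_ring)^('p mod_ring)) $ ?s i)"
  define c :: complex where "c = (if CARD('p) = 2 then \<i> else 1)"
  have bij: "bij ?s" by (rule bij_betw_byWitness[of _ "\<lambda>i. i + 1"]) auto
  then have perm: "?s permutes UNIV" by (intro bij_imp_permutes) auto
  have detP: "det ?P = of_int (sign ?s)"
    using det_permute_rows[OF perm, of "mat 1 :: complex^('p mod_ring)^('p mod_ring)"] by simp
  have "M_c = (\<chi> i. c *s ?P $ i)"
    by (auto simp: M_c_def c_def vec_eq_iff mat_def)
  then have det: "det (M_c :: complex^('p mod_ring)^('p mod_ring)) = c ^ CARD('p) * of_int (sign ?s)"
    using det_rows_mul[of "\<lambda>_. c" "\<lambda>i. ?P $ i"] detP by simp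
  have "c ^ CARD('p) * of_int (sign ?s) = 1"
  proof (cases "CARD('p) = 2")
    case True
    have "card {0, 1 :: 'p mod_ring} = card (UNIV :: 'p mod_ring set)" using True by simp
    then have U: "UNIV = {0, 1 :: 'p mod_ring}"
      by (rule card_subset_eq[OF finite subset_UNIV, symmetric])
    have *: "x = 0 \<or> x = 1" for x :: "'p mod_ring"
      using UNIV_I[of x] unfolding U by blast
    have "?s 0 = 1" using *[of "?s 0"] by auto
    then have "?s x = Transposition.transpose 0 1 x" for x
      using *[of x] by (elim disjE) auto
    then have "?s = Transposition.transpose 0 1" by (rule ext)
    then have "sign ?s = -1" by (simp add: sign_swap_id)
    then show ?thesis using True by (simp add: c_def)
  next
    case False
    then have odd: "odd CARD('p)"
      using prime_card[where 'a='p] prime_ge_2_nat[of "CARD('p)"] prime_odd_nat[of "CARD('p)"]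
      by simp
    have pow: "(?s ^^ k) i = i - of_nat k" for k i by (induction k) auto
    have "(of_nat CARD('p) :: 'p mod_ring) = 0" by simp
    then have "?s ^^ CARD('p) = id" using pow by (simp add: fun_eq_iff)
    moreover have "permutation (?s ^^ k) \<and> sign (?s ^^ k) = sign ?s ^ k" for k
    proof (induction k)
      case (Suc k)
      have "permutation ?s" using perm by (auto simp: permutation_permutes)
      with Suc permutation_compose[of ?s "?s ^^ k"] sign_compose[of ?s "?s ^^ k"]
      show ?case by (simp add: comp_def)
    qed (simp add: sign_id permutation_id)
    ultimately have "sign ?s ^ CARD('p) = 1" by (metis sign_id)
    then have "sign ?s = 1" using odd sign_def[of ?s] by (auto split: if_splits)
    then show ?thesis using False by (simp add: c_def)
  qed
  with det show ?thesis by (simp add: SL_def)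
qed

definition cyc :: "(complex^('p::prime_card mod_ring)^('p mod_ring)) set set" where
  "cyc = generate PSL {psl_proj M_c}"

definition DM :: "(complex^('p::prime_card mod_ring)^('p mod_ring)) set set" where
  "DM = Dbar <#>\<^bsub>PSL\<^esub> cyc"

text \<open>
  The natural projection onto \<open>cyc\<close>; the component \<open>m\<close> is unique because \<open>Dbar\<close> and \<open>cyc\<close>
  intersect trivially. Outside \<open>DM\<close> the value is irrelevant.
\<close>

definition semidirect_proj :: "(complex^('p::prime_card mod_ring)^('p mod_ring)) set
    \<Rightarrow> (complex^('p mod_ring)^('p mod_ring)) set" where
  "semidirect_proj x = (THE m. m \<in> cyc \<and> (\<exists>d\<in>Dbar. x = d \<otimes>\<^bsub>PSL\<^esub> m))"

section \<open>Representation spaces and their quotients\<close>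

text \<open>
  Homomorphisms are required to be undefined outside \<open>carrier \<Gamma>\<close>, so that a homomorphism
  is determined by its values on \<open>\<Gamma>\<close>.
\<close>

definition Hom :: "('g, 'm) monoid_scheme \<Rightarrow> ('a, 'b) monoid_scheme \<Rightarrow> ('g \<Rightarrow> 'a) set" where
  "Hom \<Gamma> G = hom \<Gamma> G \<inter> extensional (carrier \<Gamma>)"

text \<open>
  The topology induced by $\mathrm{Hom}(\Gamma,G)\subset G^r$, for a topology \<open>T\<close> on \<open>G\<close> and
  generators \<open>s 0, \<dots>, s (r - 1)\<close> of \<open>\<Gamma>\<close>.
\<close>

definition Hom_top :: "('g, 'm) monoid_scheme \<Rightarrow> ('a, 'b) monoid_scheme \<Rightarrow> 'a topology
    \<Rightarrow> nat \<Rightarrow> (nat \<Rightarrow> 'g) \<Rightarrow> ('g \<Rightarrow> 'a) topology" where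
  "Hom_top \<Gamma> G T r s =
     pullback_topology (Hom \<Gamma> G) (\<lambda>\<rho>. \<lambda>i\<in>{..<r}. \<rho> (s i)) (product_topology (\<lambda>_. T) {..<r})"

definition conjugate_rep :: "('g, 'm) monoid_scheme \<Rightarrow> ('a, 'b) monoid_scheme
    \<Rightarrow> 'a \<Rightarrow> ('g \<Rightarrow> 'a) \<Rightarrow> 'g \<Rightarrow> 'a" where
  "conjugate_rep \<Gamma> G g \<rho> = (\<lambda>x\<in>carrier \<Gamma>. g \<otimes>\<^bsub>G\<^esub> \<rho> x \<otimes>\<^bsub>G\<^esub> inv\<^bsub>G\<^esub> g)"

definition conj_class :: "('g, 'm) monoid_scheme \<Rightarrow> ('a, 'b) monoid_scheme \<Rightarrow> 'a set
    \<Rightarrow> ('g \<Rightarrow> 'a) \<Rightarrow> ('g \<Rightarrow> 'a) set" where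
  "conj_class \<Gamma> G K \<rho> = (\<lambda>g. conjugate_rep \<Gamma> G g \<rho>) ` K"

definition Homi_PSL :: "('g, 'm) monoid_scheme \<Rightarrow> ('g \<Rightarrow> (complex^'n^'n) set) set" where
  "Homi_PSL \<Gamma> = {\<rho> \<in> Hom \<Gamma> PSL. irreducible_subgroup (\<rho> ` carrier \<Gamma>)}"

definition Homi_DM :: "('g, 'm) monoid_scheme
    \<Rightarrow> ('g \<Rightarrow> (complex^('p::prime_card mod_ring)^('p mod_ring)) set) set" where
  "Homi_DM \<Gamma> = {\<rho> \<in> Homi_PSL \<Gamma>. \<rho> ` carrier \<Gamma> \<subseteq> DM}"

definition chii_PSL :: "('g, 'm) monoid_scheme \<Rightarrow> nat \<Rightarrow> (nat \<Rightarrow> 'g)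
    \<Rightarrow> ('g \<Rightarrow> (complex^'n^'n) set) set topology" where
  "chii_PSL \<Gamma> r s =
     quotient_topology (subtopology (Hom_top \<Gamma> PSL PSL_top r s) (Homi_PSL \<Gamma>))
       (conj_class \<Gamma> PSL (carrier PSL))"

definition chii_DM :: "('g, 'm) monoid_scheme \<Rightarrow> nat \<Rightarrow> (nat \<Rightarrow> 'g)
    \<Rightarrow> ('g \<Rightarrow> (complex^('p::prime_card mod_ring)^('p mod_ring)) set) set topology" where
  "chii_DM \<Gamma> r s =
     quotient_topology
       (subtopology (Hom_top \<Gamma> (PSL\<lparr>carrier := DM\<rparr>) (subtopology PSL_top DM) r s) (Homi_DM \<Gamma>))
       (conj_class \<Gamma> PSL DM)"

text \<open>
  The map induced by the inclusion. All members of a class \<open>c\<close> have the same class in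
  $\chi^i(\Gamma,PSL(p,\mathbb{C}))$, so the union below is that class; see \<open>phi_conj_class\<close>.
\<close>

definition phi :: "('g, 'm) monoid_scheme
    \<Rightarrow> ('g \<Rightarrow> (complex^('p::prime_card mod_ring)^('p mod_ring)) set) set
    \<Rightarrow> ('g \<Rightarrow> (complex^('p mod_ring)^('p mod_ring)) set) set" where
  "phi \<Gamma> c = (\<Union>\<rho>\<in>c. conj_class \<Gamma> PSL (carrier PSL) \<rho>)"

lemma phi_conj_class:
  fixes \<rho> :: "'g \<Rightarrow> (complex^('p::prime_card mod_ring)^('p mod_ring)) set"
  assumes \<rho>: "\<rho> \<in> Hom \<Gamma> PSL"
  shows "phi \<Gamma> (conj_class \<Gamma> PSL DM \<rho>) = conj_class \<Gamma> PSL (carrier PSL) \<rho>"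
proof -
  interpret P: group "PSL :: (complex^('p mod_ring)^('p mod_ring)) set monoid"
    by (rule group_PSL)
  interpret S: group "SL :: (complex^('p mod_ring)^('p mod_ring)) monoid"
    by (rule group_SL)
  have val: "\<rho> x \<in> carrier PSL" if "x \<in> carrier \<Gamma>" for x
    using \<rho> that by (auto simp: Hom_def hom_def)
  have proj: "psl_proj A \<in> carrier PSL"
    if "A \<in> carrier SL" for A :: "complex^('p mod_ring)^('p mod_ring)"
    using psl_proj_hom that by (auto simp: hom_def)
  have "cyc \<subseteq> carrier (PSL :: (complex^('p mod_ring)^('p mod_ring)) set monoid)"
    unfolding cyc_def using M_c_in_SL by (intro P.generate_incl) (auto intro: proj)
  moreover have "Dbar \<subseteq> carrier (PSL :: (complex^('p mod_ring)^('p mod_ring)) set monoid)"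
    by (auto simp: Dbar_def intro: proj)
  ultimately have DM: "DM \<subseteq> carrier (PSL :: (complex^('p mod_ring)^('p mod_ring)) set monoid)"
    unfolding DM_def by (rule P.set_mult_closed[rotated])
  have "mat 1 \<in> {A \<in> carrier SL. \<forall>i j. i \<noteq> j \<longrightarrow> A $ i $ j = (0::complex)}"
    by (simp add: SL_def) (simp add: mat_def)
  then have ne: "DM \<noteq> ({} :: (complex^('p mod_ring)^('p mod_ring)) set set)"
    unfolding DM_def Dbar_def cyc_def set_mult_def by (auto intro: generate.one)
  have conj2: "conjugate_rep \<Gamma> PSL h (conjugate_rep \<Gamma> PSL g \<rho>) = conjugate_rep \<Gamma> PSL (h \<otimes>\<^bsub>PSL\<^esub> g) \<rho>"
    if "g \<in> carrier PSL" "h \<in> carrier PSL" for g h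
    using that val by (auto simp: conjugate_rep_def restrict_def fun_eq_iff P.inv_mult_group P.m_assoc)
  have "conj_class \<Gamma> PSL (carrier PSL) (conjugate_rep \<Gamma> PSL g \<rho>) = conj_class \<Gamma> PSL (carrier PSL) \<rho>"
    if g: "g \<in> carrier PSL" for g
  proof
    show "conj_class \<Gamma> PSL (carrier PSL) (conjugate_rep \<Gamma> PSL g \<rho>) \<subseteq> conj_class \<Gamma> PSL (carrier PSL) \<rho>"
      using g by (auto simp: conj_class_def conj2)
    show "conj_class \<Gamma> PSL (carrier PSL) \<rho> \<subseteq> conj_class \<Gamma> PSL (carrier PSL) (conjugate_rep \<Gamma> PSL g \<rho>)"
    proof
      fix \<tau> assume "\<tau> \<in> conj_class \<Gamma> PSL (carrier PSL) \<rho>"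
      then obtain h where h: "h \<in> carrier PSL" "\<tau> = conjugate_rep \<Gamma> PSL h \<rho>"
        by (auto simp: conj_class_def)
      then have "\<tau> = conjugate_rep \<Gamma> PSL (h \<otimes>\<^bsub>PSL\<^esub> inv\<^bsub>PSL\<^esub> g) (conjugate_rep \<Gamma> PSL g \<rho>)"
        using g by (simp add: conj2 P.m_assoc)
      moreover have "h \<otimes>\<^bsub>PSL\<^esub> inv\<^bsub>PSL\<^esub> g \<in> carrier PSL" using g h by simp
      ultimately show "\<tau> \<in> conj_class \<Gamma> PSL (carrier PSL) (conjugate_rep \<Gamma> PSL g \<rho>)"
        unfolding conj_class_def by blast
    qed
  qed
  moreover have "phi \<Gamma> (conj_class \<Gamma> PSL DM \<rho>)
      = (\<Union>g\<in>DM. conj_class \<Gamma> PSL (carrier PSL) (conjugate_rep \<Gamma> PSL g \<rho>))"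
    by (simp add: phi_def conj_class_def[of _ _ DM])
  ultimately have "phi \<Gamma> (conj_class \<Gamma> PSL DM \<rho>)
      = (\<Union>g\<in>(DM :: (complex^('p mod_ring)^('p mod_ring)) set set). conj_class \<Gamma> PSL (carrier PSL) \<rho>)"
    using DM by (metis (no_types, lifting) SUP_cong subsetD)
  with ne show ?thesis by simp
qed

definition H_rep :: "('g, 'm) monoid_scheme
    \<Rightarrow> ('g \<Rightarrow> (complex^('p::prime_card mod_ring)^('p mod_ring)) set)
    \<Rightarrow> ('g \<Rightarrow> (complex^('p mod_ring)^('p mod_ring)) set) set" where
  "H_rep \<Gamma> \<rho>bar = {\<rho> \<in> Homi_DM \<Gamma>. \<forall>x\<in>carrier \<Gamma>. semidirect_proj (\<rho> x) = \<rho>bar x}"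

definition H_class :: "('g, 'm) monoid_scheme
    \<Rightarrow> ('g \<Rightarrow> (complex^('p::prime_card mod_ring)^('p mod_ring)) set)
    \<Rightarrow> ('g \<Rightarrow> (complex^('p mod_ring)^('p mod_ring)) set) set set" where
  "H_class \<Gamma> \<rho>bar = conj_class \<Gamma> PSL DM ` H_rep \<Gamma> \<rho>bar"

end

theory Submission
  imports Defs
begin

text \<open>
  An element of $PSL(p,\mathbb{C})$ lies in \<open>DM\<close> exactly when it lifts to a monomial matrix whose
  permutation is a translation $j \mapsto j + k$ of $\mathbb{Z}/p$, and the natural projection
  records \<open>k\<close> (\<open>DM_iff\<close>, \<open>semidirect_proj_eq_iff\<close>). So \<open>H_rep \<Gamma> \<rho>bar\<close> consists of the irreducible
  \<open>\<rho>\<close> for which \<open>\<rho> x\<close> translates by a number \<open>\<kappa> x\<close> that depends only on \<open>\<rho>bar\<close>. Some \<open>\<gamma>\<close> has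
  \<open>\<kappa> \<gamma> \<noteq> 0\<close>, and the elements of $\Gamma_0 = \ker \kappa$ act by diagonal matrices.

  The algebraic core is that irreducibility makes any two of the \<open>p\<close> diagonal entries differ somewhere
  on $\Gamma_0$ (\<open>irreducible_separates\<close>). Conjugation by \<open>\<gamma>\<close> translates the set of pairs of
  coordinates that agree on $\Gamma_0$; since \<open>p\<close> is prime, one such pair would force all coordinates
  to agree. Then $\Gamma_0$ would act trivially, the image of \<open>\<rho>\<close> would be generated by \<open>\<rho> \<gamma>\<close>, and it
  would fix the line spanned by an eigenvector. Consequently the coordinate lines are
  the simultaneous eigenlines of $\Gamma_0$. A matrix that conjugates one member of \<open>H_rep \<Gamma> \<rho>bar\<close> into
  another permutes these lines, and compatibility with \<open>\<gamma>\<close> makes the permutation a translation: the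
  matrix represents an element of \<open>DM\<close> (\<open>intertwiner_monomial\<close>, \<open>conjugator_in_DM\<close>). This
  gives injectivity.

  Continuity of the map is formal. For openness, let $\rho_n \to \rho$ be irreducible
  representations with \<open>\<rho>\<close> and all $\tau_n = g_n \rho_n g_n^{-1}$ in \<open>H_rep \<Gamma> \<rho>bar\<close>. The matrices
  $g_n$ may be unbounded, but scaling their rows to unit length multiplies $g_n$ by a diagonal
  matrix, hence conjugates $\tau_n$ within \<open>DM\<close>. After this normalization a subsequence converges to
  a matrix \<open>u\<close> with nonzero rows. The intertwining relation, stated row by row up to
  proportionality, is a closed condition, so it holds for \<open>u\<close> and \<open>\<rho>\<close>, and the same rigidity statement
  shows that \<open>u\<close> is invertible and represents an element of \<open>DM\<close>. Hence \<open>DM\<close>-conjugates of the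
  $\tau_n$ subconverge to a \<open>DM\<close>-conjugate of \<open>\<rho>\<close> (\<open>conjugates_subconverge\<close>), and classes close to that
  of \<open>\<rho>\<close> in the target come from classes close to that of \<open>\<rho>\<close> in the source.
  Arguing with sequences is legitimate because lifts of the
  generators to $SL(p,\mathbb{C})$ provide countable neighbourhood bases (\<open>Hom_nhd_sequentially\<close>).
\<close>

section \<open>Matrices and their images in $PSL(n,\mathbb{C})$\<close>

lemma matrix_inv_det_nonzero:
  fixes A :: "'a::field^'n^'n"
  assumes "det A \<noteq> 0"
  shows "A ** matrix_inv A = mat 1" and "matrix_inv A ** A = mat 1"
proof -
  have "\<exists>B. A ** B = mat 1 \<and> B ** A = mat 1"
    using assms by (simp add: invertible_det_nz[symmetric] invertible_def)
  from someI_ex[OF this] show "A ** matrix_inv A = mat 1" "matrix_inv A ** A = mat 1"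
    by (simp_all add: matrix_inv_def)
qed

lemma tendsto_matrix_mult [tendsto_intros]:
  fixes A :: "'b \<Rightarrow> complex^'n^'m" and B :: "'b \<Rightarrow> complex^'k^'n"
  assumes "(A \<longlongrightarrow> a) F" "(B \<longlongrightarrow> b) F"
  shows "((\<lambda>x. A x ** B x) \<longlongrightarrow> a ** b) F"
  unfolding matrix_matrix_mult_def
  by (intro tendsto_vec_lambda tendsto_sum tendsto_mult tendsto_vec_nth assms)

lemma tendsto_det [tendsto_intros]:
  fixes A :: "'b \<Rightarrow> complex^'n^'n"
  assumes "(A \<longlongrightarrow> a) F"
  shows "((\<lambda>x. det (A x)) \<longlongrightarrow> det a) F"
  unfolding det_def
  by (intro tendsto_sum tendsto_mult tendsto_prod tendsto_vec_nth assms tendsto_const)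

text \<open>Cramer's rule expresses the entries of the inverse through determinants.\<close>

lemma matrix_inv_nth:
  fixes A :: "complex^'n^'n"
  assumes "det A \<noteq> 0"
  shows "matrix_inv A $ k $ j
    = det (\<chi> i l. if l = k then (if i = j then 1 else 0) else A $ i $ l) / det A"
proof -
  have "A *v column j (matrix_inv A) = column j (A ** matrix_inv A)"
    by (simp add: vec_eq_iff column_def matrix_vector_mult_def matrix_matrix_mult_def)
  also have "\<dots> = axis j 1"
    by (auto simp: matrix_inv_det_nonzero[OF assms] vec_eq_iff column_def mat_def axis_def)
  finally have "column j (matrix_inv A)
      = (\<chi> k. det (\<chi> i l. if l = k then axis j 1 $ i else A $ i $ l) / det A)"
    by (simp only: cramer[OF assms])
  then have "column j (matrix_inv A) $ k
      = det (\<chi> i l. if l = k then axis j 1 $ i else A $ i $ l) / det A" by simp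
  moreover have "(\<chi> i l. if l = k then axis j 1 $ i else A $ i $ l)
      = (\<chi> i l. if l = k then (if i = j then 1 else 0) else A $ i $ l)"
    by (auto simp: vec_eq_iff axis_def)
  ultimately show ?thesis by (simp add: column_def)
qed

lemma tendsto_matrix_inv:
  fixes A :: "nat \<Rightarrow> complex^'n^'n"
  assumes "A \<longlonglongrightarrow> a" and "det a \<noteq> 0" and "\<And>n. det (A n) \<noteq> 0"
  shows "(\<lambda>n. matrix_inv (A n)) \<longlonglongrightarrow> matrix_inv a"
proof (intro vec_tendstoI)
  fix k j
  have "(\<lambda>n. det (\<chi> i l. if l = k then (if i = j then 1 else 0) else A n $ i $ l) / det (A n))
      \<longlonglongrightarrow> det (\<chi> i l. if l = k then (if i = j then 1 else 0) else a $ i $ l) / det a"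
  proof (intro tendsto_divide tendsto_det tendsto_vec_lambda)
    fix i l
    show "(\<lambda>n. if l = k then (if i = j then 1 else 0) else A n $ i $ l)
        \<longlonglongrightarrow> (if l = k then (if i = j then 1 else 0) else a $ i $ l)"
      by (cases "l = k") (auto intro!: tendsto_vec_nth assms)
  qed (use assms in auto)
  then show "(\<lambda>n. matrix_inv (A n) $ k $ j) \<longlonglongrightarrow> matrix_inv a $ k $ j"
    by (simp only: matrix_inv_nth assms not_False_eq_True)
qed

lemma mat_mult_nth: "(mat c ** A) $ i $ j = c * (A $ i $ j)"
  for A :: "complex^'n^'m"
  by (simp add: matrix_matrix_mult_def mat_def if_distrib if_distribR cong: if_cong)

lemma mult_mat_nth: "(A ** mat c) $ i $ j = c * (A $ i $ j)"
  for A :: "complex^'n^'m"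
  by (simp add: matrix_matrix_mult_def mat_def if_distrib if_distribR mult.commute cong: if_cong)

lemma mat_commute: "mat c ** A = A ** mat c" for A :: "complex^'n^'n"
  by (simp add: vec_eq_iff mat_mult_nth mult_mat_nth)

lemma det_mat: "det (mat c :: complex^'n^'n) = c ^ CARD('n)"
proof -
  have "mat c = (\<chi> i. c *s (mat 1 :: complex^'n^'n) $ i)"
    by (auto simp: vec_eq_iff mat_def)
  then show ?thesis using det_rows_mul[of "\<lambda>_. c" "\<lambda>i. (mat 1 :: complex^'n^'n) $ i"] by simp
qed

definition transvection :: "'n \<Rightarrow> 'n \<Rightarrow> complex^'n^'n" where
  "transvection i j = (\<chi> k l. (if k = l then 1 else 0) + (if k = i \<and> l = j then 1 else 0))"

lemma det_transvection: "i \<noteq> j \<Longrightarrow> det (transvection i j) = 1"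
proof -
  assume ij: "i \<noteq> j"
  have "transvection i j
      = (\<chi> k. if k = i then row i (mat 1) + 1 *s row j (mat 1) else row k (mat 1))"
    using ij by (auto simp: vec_eq_iff transvection_def row_def mat_def)
  with det_row_operation[OF ij, of "mat 1 :: complex^_^_" 1] show ?thesis by simp
qed

lemma transvection_mult_nth:
  "(transvection i j ** A) $ k $ l = A $ k $ l + (if k = i then A $ j $ l else 0)"
proof -
  have "(transvection i j ** A) $ k $ l
      = (\<Sum>m\<in>UNIV. (if m = k then A $ m $ l else 0)
          + (if m = j then (if k = i then A $ m $ l else 0) else 0))"
    unfolding matrix_matrix_mult_def transvection_def by (auto intro!: sum.cong)
  then show ?thesis by (simp add: sum.distrib)
qed

lemma mult_transvection_nth:
  "(A ** transvection i j) $ k $ l = A $ k $ l + (if l = j then A $ k $ i else 0)"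
proof -
  have "(A ** transvection i j) $ k $ l
      = (\<Sum>m\<in>UNIV. (if m = l then A $ k $ m else 0)
          + (if m = i then (if l = j then A $ k $ m else 0) else 0))"
    unfolding matrix_matrix_mult_def transvection_def by (auto intro!: sum.cong)
  then show ?thesis by (simp add: sum.distrib)
qed

lemma transvection_mult_vec: "transvection i j *v v = v + (v $ j) *s axis i 1"
proof -
  have "(transvection i j *v v) $ k = v $ k + (if k = i then v $ j else 0)" for k
  proof -
    have "(transvection i j *v v) $ k
        = (\<Sum>m\<in>UNIV. (if m = k then v $ m else 0)
          + (if m = j then (if k = i then v $ m else 0) else 0))"
      unfolding matrix_vector_mult_def transvection_def by (auto intro!: sum.cong)
    then show ?thesis by (simp add: sum.distrib)
  qed
  then show ?thesis by (auto simp: vec_eq_iff axis_def)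
qed

text \<open>Commuting with every transvection forces a matrix to be scalar.\<close>

lemma center_SL_scalar:
  fixes z :: "complex^'n^'n"
  assumes "z \<in> group_center SL"
  shows "\<exists>c. z = mat c"
proof -
  have comm: "z ** transvection i j = transvection i j ** z" if "i \<noteq> j" for i j
    using assms that by (simp add: group_center_def SL_def det_transvection)
  have e: "z $ k $ l + (if l = j then z $ k $ i else 0) = z $ k $ l + (if k = i then z $ j $ l else 0)"
    if "i \<noteq> j" for i j k l
    using arg_cong[OF comm[OF that], of "\<lambda>m. m $ k $ l"]
    by (simp only: mult_transvection_nth transvection_mult_nth)
  have off: "z $ k $ i = 0" if "k \<noteq> i" for k i
    using e[of i k k k] that by simp
  have diag: "z $ i $ i = z $ j $ j" for i j
    using e[of i j i j] by (cases "i = j") auto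
  obtain i0 :: 'n where True by simp
  have "z = mat (z $ i0 $ i0)"
    unfolding vec_eq_iff
  proof (intro allI)
    fix i j show "z $ i $ j = mat (z $ i0 $ i0) $ i $ j"
      using off[of i j] diag[of i i0] by (cases "i = j") (auto simp: mat_def)
  qed
  then show ?thesis by blast
qed

lemma in_carrier_SL [simp]: "A \<in> carrier SL \<longleftrightarrow> det A = 1"
  by (simp add: SL_def)

lemma mult_SL [simp]: "A \<otimes>\<^bsub>SL\<^esub> B = A ** B"
  by (simp add: SL_def)

lemma one_SL [simp]: "\<one>\<^bsub>SL\<^esub> = mat 1"
  by (simp add: SL_def)

lemma mat_in_center_SL: "det (mat c :: complex^'n^'n) = 1 \<Longrightarrow> (mat c :: complex^'n^'n) \<in> group_center SL"
  by (auto simp: group_center_def mat_commute)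

lemma psl_proj_eq_iff:
  fixes A B :: "complex^'n^'n"
  assumes "det A = 1" "det B = 1"
  shows "psl_proj A = psl_proj B \<longleftrightarrow> (\<exists>c. A = mat c ** B)"
proof
  interpret S: group "SL :: (complex^'n^'n) monoid" by (rule group_SL)
  interpret N: normal "group_center SL" "SL :: (complex^'n^'n) monoid"
    by (rule S.normal_group_center)
  {
    assume "psl_proj A = psl_proj B"
    then have "A \<in> group_center SL #>\<^bsub>SL\<^esub> B"
      using S.rcos_self[of A "group_center SL"] N.subgroup_axioms assms by (simp add: psl_proj_def)
    then show "\<exists>c. A = mat c ** B"
      by (auto simp: r_coset_def dest: center_SL_scalar)
  }
  assume "\<exists>c. A = mat c ** B"
  then obtain c where c: "A = mat c ** B" by blast
  with assms have "det (mat c :: complex^'n^'n) = 1" by (simp add: det_mul)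
  then have z: "(mat c :: complex^'n^'n) \<in> group_center SL" by (rule mat_in_center_SL)
  then have "(group_center SL #>\<^bsub>SL\<^esub> (mat c)) #>\<^bsub>SL\<^esub> B = group_center SL #>\<^bsub>SL\<^esub> (mat c \<otimes>\<^bsub>SL\<^esub> B)"
    using assms N.subset by (intro S.coset_mult_assoc) auto
  moreover have "group_center SL #>\<^bsub>SL\<^esub> (mat c) = (group_center SL :: (complex^'n^'n) set)"
    using subsetD[OF N.subset z] N.subgroup_axioms z by (rule S.coset_join2)
  ultimately show "psl_proj A = psl_proj B"
    using c by (simp add: psl_proj_def)
qed

lemma psl_proj_mult:
  fixes A B :: "complex^'n^'n"
  assumes "det A = 1" "det B = 1"
  shows "psl_proj A \<otimes>\<^bsub>PSL\<^esub> psl_proj B = psl_proj (A ** B)"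
  using hom_mult[OF psl_proj_hom, of A B] assms by simp

lemma psl_proj_in_PSL: "det A = 1 \<Longrightarrow> psl_proj A \<in> carrier PSL"
  using hom_in_carrier[OF psl_proj_hom, of A] by simp

lemma psl_proj_one: "psl_proj (mat 1 :: complex^'n^'n) = \<one>\<^bsub>PSL\<^esub>"
  using hom_one[OF psl_proj_hom group_SL group_PSL] by simp

lemma PSL_cases:
  assumes "X \<in> carrier PSL"
  obtains A where "det A = 1" "X = psl_proj A"
  using assms by (auto simp: PSL_def carrier_FactGroup psl_proj_def)

lemma det_matrix_inv: "det A = 1 \<Longrightarrow> det (matrix_inv A) = 1" for A :: "complex^'n^'n"
  using arg_cong[OF matrix_inv_det_nonzero(1)[of A], of det] by (simp add: det_mul)

lemma psl_proj_inv:
  fixes A :: "complex^'n^'n"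
  assumes "det A = 1"
  shows "inv\<^bsub>PSL\<^esub> (psl_proj A) = psl_proj (matrix_inv A)"
proof -
  interpret P: group "PSL :: (complex^'n^'n) set monoid" by (rule group_PSL)
  have "psl_proj A \<otimes>\<^bsub>PSL\<^esub> psl_proj (matrix_inv A) = \<one>\<^bsub>PSL\<^esub>"
    using assms
    by (simp add: psl_proj_mult det_matrix_inv matrix_inv_det_nonzero psl_proj_one)
  then show ?thesis
    using assms
    by (intro P.inv_equality P.inv_comm[of "psl_proj A"]) (auto simp: psl_proj_in_PSL det_matrix_inv)
qed

lemma det_conj: "det u \<noteq> 0 \<Longrightarrow> det (u ** A ** matrix_inv u) = det A" for A :: "complex^'n^'n"
  using arg_cong[OF matrix_inv_det_nonzero(1)[of u], of det] by (simp add: det_mul mult_ac)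

text \<open>Conjugation by an arbitrary invertible matrix is inner on $PSL$: over $\mathbb{C}$ the
  matrix may be rescaled to have determinant 1, and the scalar cancels.\<close>

lemma psl_conj_GL:
  fixes u :: "complex^'n^'n"
  assumes u: "det u \<noteq> 0"
  obtains c where "det (mat c ** u) = 1"
    "\<And>A. det A = 1 \<Longrightarrow> psl_proj (mat c ** u) \<otimes>\<^bsub>PSL\<^esub> psl_proj A \<otimes>\<^bsub>PSL\<^esub> inv\<^bsub>PSL\<^esub> (psl_proj (mat c ** u))
       = psl_proj (u ** A ** matrix_inv u)"
proof -
  define d where "d = exp (Ln (det u) / of_nat CARD('n))"
  have d: "d ^ CARD('n) = det u"
    using u by (simp add: d_def exp_of_nat_mult[symmetric])
  define c where "c = inverse d"
  have d0: "d \<noteq> 0" by (simp add: d_def)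
  have c: "c \<noteq> 0" "c ^ CARD('n) * det u = 1"
    using u d d0 by (simp_all add: c_def power_inverse)
  then have dv: "det (mat c ** u) = 1" by (simp add: det_mul det_mat)
  have "psl_proj (mat c ** u) \<otimes>\<^bsub>PSL\<^esub> psl_proj A \<otimes>\<^bsub>PSL\<^esub> inv\<^bsub>PSL\<^esub> (psl_proj (mat c ** u))
       = psl_proj (u ** A ** matrix_inv u)" if A: "det A = 1" for A
  proof -
    let ?v = "mat c ** u"
    have 1: "?v ** A = (u ** A ** matrix_inv u) ** ?v"
    proof -
      have "(u ** A ** matrix_inv u) ** (u ** mat c) = u ** A ** (matrix_inv u ** u) ** mat c"
        by (simp only: matrix_mul_assoc)
      then show ?thesis
        using u by (simp add: matrix_inv_det_nonzero mat_commute)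
          (metis mat_commute matrix_mul_assoc)
    qed
    have "?v ** A ** matrix_inv ?v = (u ** A ** matrix_inv u) ** (?v ** matrix_inv ?v)"
      unfolding 1 by (simp only: matrix_mul_assoc)
    also have "\<dots> = u ** A ** matrix_inv u"
      using dv by (simp add: matrix_inv_det_nonzero)
    finally show ?thesis
      using dv A by (simp add: psl_proj_mult psl_proj_inv det_mul det_matrix_inv)
  qed
  with dv show thesis by (rule that)
qed

section \<open>Convergence of representations\<close>

text \<open>
  Convergence in $PSL(n,\mathbb{C})$ expressed through lifts, so that limits can be computed with
  matrices.
\<close>

definition psl_tendsto :: "(nat \<Rightarrow> (complex^'n^'n) set) \<Rightarrow> (complex^'n^'n) set \<Rightarrow> bool" where
  "psl_tendsto X Y \<longleftrightarrow> (\<exists>A B. (\<forall>n. det (A n) = 1 \<and> X n = psl_proj (A n)) \<and>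
     det B = 1 \<and> Y = psl_proj B \<and> A \<longlonglongrightarrow> B)"

lemma psl_tendstoI:
  assumes "\<And>n. det (A n) = 1" "\<And>n. X n = psl_proj (A n)" "det B = 1" "Y = psl_proj B" "A \<longlonglongrightarrow> B"
  shows "psl_tendsto X Y"
  using assms unfolding psl_tendsto_def by blast

lemma psl_tendstoE:
  assumes "psl_tendsto X Y"
  obtains A B where "\<And>n. det (A n) = 1" "\<And>n. X n = psl_proj (A n)" "det B = 1" "Y = psl_proj B"
    "A \<longlonglongrightarrow> B"
  using assms unfolding psl_tendsto_def by blast

lemma psl_tendsto_const: "X \<in> carrier PSL \<Longrightarrow> psl_tendsto (\<lambda>_. X) X"
  by (erule PSL_cases) (auto intro!: psl_tendstoI)

lemma psl_tendsto_mult: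
  assumes "psl_tendsto X Y" "psl_tendsto X' Y'"
  shows "psl_tendsto (\<lambda>n. X n \<otimes>\<^bsub>PSL\<^esub> X' n) (Y \<otimes>\<^bsub>PSL\<^esub> Y')"
proof -
  obtain A B where AB: "\<And>n. det (A n) = 1" "\<And>n. X n = psl_proj (A n)" "det B = 1" "Y = psl_proj B"
    "A \<longlonglongrightarrow> B" by (rule psl_tendstoE[OF assms(1)]) blast
  obtain A' B' where AB': "\<And>n. det (A' n) = 1" "\<And>n. X' n = psl_proj (A' n)" "det B' = 1" "Y' = psl_proj B'"
    "A' \<longlonglongrightarrow> B'" by (rule psl_tendstoE[OF assms(2)]) blast
  show ?thesis
    by (rule psl_tendstoI[of "\<lambda>n. A n ** A' n" _ "B ** B'"])
      (auto simp: AB AB' det_mul psl_proj_mult intro!: tendsto_matrix_mult)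
qed

lemma psl_tendsto_inv:
  assumes "psl_tendsto X Y"
  shows "psl_tendsto (\<lambda>n. inv\<^bsub>PSL\<^esub> (X n)) (inv\<^bsub>PSL\<^esub> Y)"
proof -
  obtain A B where AB: "\<And>n. det (A n) = 1" "\<And>n. X n = psl_proj (A n)" "det B = 1" "Y = psl_proj B"
    "A \<longlonglongrightarrow> B" by (rule psl_tendstoE[OF assms]) blast
  show ?thesis
    by (rule psl_tendstoI[of "\<lambda>n. matrix_inv (A n)" _ "matrix_inv B"])
      (auto simp: AB det_matrix_inv psl_proj_inv intro!: tendsto_matrix_inv)
qed

lemma psl_tendsto_subseq:
  assumes "psl_tendsto X Y" "strict_mono \<phi>"
  shows "psl_tendsto (\<lambda>n. X (\<phi> n)) Y"
proof -
  obtain A B where AB: "\<And>n. det (A n) = 1" "\<And>n. X n = psl_proj (A n)" "det B = 1" "Y = psl_proj B"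
    "A \<longlonglongrightarrow> B" by (rule psl_tendstoE[OF assms(1)]) blast
  show ?thesis
    by (rule psl_tendstoI[of "A \<circ> \<phi>" _ B])
      (use AB in \<open>auto intro!: LIMSEQ_subseq_LIMSEQ assms(2)\<close>)
qed

lemma psl_tendsto_limitin:
  fixes X :: "nat \<Rightarrow> (complex^'n^'n) set"
  assumes "psl_tendsto X Y"
  shows "limitin PSL_top X Y sequentially"
proof -
  obtain A B where AB: "\<And>n. det (A n) = 1" "\<And>n. X n = psl_proj (A n)" "det B = 1" "Y = psl_proj B"
    "A \<longlonglongrightarrow> B" by (rule psl_tendstoE[OF assms(1)]) blast
  have "continuous_map (subtopology euclidean (carrier SL)) PSL_top (psl_proj :: complex^'n^'n \<Rightarrow> _)"
    unfolding PSL_top_def by (rule quotient_imp_continuous_map[OF quotient_map_quotient_topology])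
  moreover have "limitin (subtopology euclidean (carrier SL)) A B sequentially"
    using AB by (simp add: limitin_subtopology)
  ultimately have "limitin PSL_top (psl_proj \<circ> A) (psl_proj B) sequentially"
    by (rule continuous_map_limit)
  moreover have "X = psl_proj \<circ> A" using AB(2) by (simp add: fun_eq_iff)
  ultimately show ?thesis using AB(4) by simp
qed

text \<open>The preimage of the image of an open set is a union of translates by central matrices.\<close>

lemma openin_psl_proj_image:
  fixes U :: "(complex^'n^'n) set"
  assumes "open U"
  shows "openin PSL_top (psl_proj ` (U \<inter> carrier SL))"
  unfolding PSL_top_def openin_quotient_topology
proof
  let ?T = "subtopology euclidean (carrier SL) :: (complex^'n^'n) topology"
  show "psl_proj ` (U \<inter> carrier SL) \<subseteq> psl_proj ` topspace ?T" by auto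
  have eq: "{A \<in> topspace ?T. psl_proj A \<in> psl_proj ` (U \<inter> carrier SL)}
      = carrier SL \<inter> (\<Union>c\<in>{c. det (mat c :: complex^'n^'n) = 1}. (\<lambda>A. mat c ** A) -` U)" (is "?L = ?R")
  proof (intro equalityI subsetI)
    fix A assume "A \<in> ?L"
    then obtain B where B: "det A = 1" "det B = 1" "B \<in> U" "psl_proj B = psl_proj A" by auto
    then obtain c where "B = mat c ** A" by (auto simp: psl_proj_eq_iff)
    moreover from this B have "det (mat c :: complex^'n^'n) = 1" by (simp add: det_mul)
    ultimately show "A \<in> ?R" using B by auto
  next
    fix A assume "A \<in> ?R"
    then obtain c where c: "det A = 1" "det (mat c :: complex^'n^'n) = 1" "mat c ** A \<in> U" by auto
    then have "det (mat c ** A) = 1" by (simp add: det_mul)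
    moreover from this c have "psl_proj (mat c ** A) = psl_proj A" by (auto simp: psl_proj_eq_iff)
    ultimately have "psl_proj A \<in> psl_proj ` (U \<inter> carrier SL)" using c(3)
      by (metis IntI imageI in_carrier_SL)
    then show "A \<in> ?L" using c(1) by simp
  qed
  have "continuous_on UNIV (\<lambda>A :: complex^'n^'n. mat c ** A)" for c
    unfolding continuous_on_def by (auto intro!: tendsto_intros)
  then have "open ((\<lambda>A :: complex^'n^'n. mat c ** A) -` U)" for c
    using assms by (simp add: continuous_on_open_vimage)
  then have "open (\<Union>c\<in>{c. det (mat c :: complex^'n^'n) = 1}. (\<lambda>A :: complex^'n^'n. mat c ** A) -` U)"
    by blast
  then show "openin ?T {A \<in> topspace ?T. psl_proj A \<in> psl_proj ` (U \<inter> carrier SL)}"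
    unfolding eq by (simp add: openin_open_Int)
qed

lemma Hom_carrier: "\<rho> \<in> Hom \<Gamma> G \<Longrightarrow> x \<in> carrier \<Gamma> \<Longrightarrow> \<rho> x \<in> carrier G"
  by (auto simp: Hom_def hom_def)

lemma Hom_mult: "\<rho> \<in> Hom \<Gamma> G \<Longrightarrow> x \<in> carrier \<Gamma> \<Longrightarrow> y \<in> carrier \<Gamma>
    \<Longrightarrow> \<rho> (x \<otimes>\<^bsub>\<Gamma>\<^esub> y) = \<rho> x \<otimes>\<^bsub>G\<^esub> \<rho> y"
  by (auto simp: Hom_def hom_def)

lemma Hom_hom: "\<rho> \<in> Hom \<Gamma> G \<Longrightarrow> \<rho> \<in> hom \<Gamma> G"
  by (auto simp: Hom_def)

lemma Hom_one: "\<rho> \<in> Hom \<Gamma> PSL \<Longrightarrow> group \<Gamma> \<Longrightarrow> \<rho> \<one>\<^bsub>\<Gamma>\<^esub> = \<one>\<^bsub>PSL\<^esub>"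
  using hom_one[OF Hom_hom _ group_PSL] by blast

lemma Hom_inv: "\<rho> \<in> Hom \<Gamma> PSL \<Longrightarrow> group \<Gamma> \<Longrightarrow> x \<in> carrier \<Gamma>
    \<Longrightarrow> \<rho> (inv\<^bsub>\<Gamma>\<^esub> x) = inv\<^bsub>PSL\<^esub> (\<rho> x)"
  using group_hom.hom_inv[of \<Gamma> PSL \<rho> x] group_PSL
  by (auto simp: group_hom_def group_hom_axioms_def Hom_def)

text \<open>Products and inverses of convergent lifts converge, so convergence spreads from generators to words.\<close>

lemma psl_tendsto_generate:
  fixes \<rho>s :: "nat \<Rightarrow> 'g \<Rightarrow> (complex^'n^'n) set"
  assumes "group \<Gamma>" "S \<subseteq> carrier \<Gamma>"
    and \<rho>s: "\<And>n. \<rho>s n \<in> Hom \<Gamma> PSL" and \<rho>: "\<rho> \<in> Hom \<Gamma> PSL"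
    and S: "\<And>x. x \<in> S \<Longrightarrow> psl_tendsto (\<lambda>n. \<rho>s n x) (\<rho> x)"
    and x: "x \<in> generate \<Gamma> S"
  shows "psl_tendsto (\<lambda>n. \<rho>s n x) (\<rho> x)"
  using x
proof (induction rule: generate.induct)
  case one
  then show ?case
    using psl_tendsto_const[OF psl_proj_in_PSL, of "mat 1"]
    by (simp add: Hom_one[OF \<rho>s assms(1)] Hom_one[OF \<rho> assms(1)] psl_proj_one)
next
  case (incl h)
  then show ?case by (rule S)
next
  case (inv h)
  then have "h \<in> carrier \<Gamma>" using assms(2) by blast
  with psl_tendsto_inv[OF S[OF inv]] show ?case
    by (simp add: Hom_inv[OF \<rho>s assms(1)] Hom_inv[OF \<rho> assms(1)])
next
  case (eng h1 h2)
  then have "h1 \<in> carrier \<Gamma>" "h2 \<in> carrier \<Gamma>"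
    using group.generate_in_carrier[OF assms(1,2)] by auto
  with psl_tendsto_mult[OF eng.IH] show ?case
    by (simp add: Hom_mult[OF \<rho>s] Hom_mult[OF \<rho>])
qed

lemma eventually_in_open_Hom:
  fixes \<rho>s :: "nat \<Rightarrow> 'g \<Rightarrow> (complex^'n^'n) set"
  assumes s: "s ` {..<r} \<subseteq> carrier \<Gamma>"
    and O: "openin (Hom_top \<Gamma> PSL PSL_top r s) O'" "\<rho> \<in> O'"
    and \<rho>s: "\<And>n. \<rho>s n \<in> Hom \<Gamma> PSL"
    and conv: "\<And>x. x \<in> s ` {..<r} \<Longrightarrow> psl_tendsto (\<lambda>n. \<rho>s n x) (\<rho> x)"
  shows "\<forall>\<^sub>F n in sequentially. \<rho>s n \<in> O'"
proof -
  let ?f = "\<lambda>\<rho>. \<lambda>i\<in>{..<r}. \<rho> (s i) :: (complex^'n^'n) set"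
  let ?P = "product_topology (\<lambda>_. PSL_top) {..<r} :: (nat \<Rightarrow> (complex^'n^'n) set) topology"
  obtain U where U: "openin ?P U" "O' = ?f -` U \<inter> Hom \<Gamma> PSL"
    using O(1) by (auto simp: Hom_top_def openin_pullback_topology)
  have "limitin ?P (\<lambda>n. ?f (\<rho>s n)) (?f \<rho>) sequentially"
    unfolding limitin_componentwise
  proof (intro conjI ballI)
    fix i assume "i \<in> {..<r}"
    then show "limitin PSL_top (\<lambda>n. ?f (\<rho>s n) i) (?f \<rho> i) sequentially"
      using psl_tendsto_limitin[OF conv[of "s i"]] by simp
  next
    have "?f (\<rho>s n) \<in> topspace ?P" for n
      using s Hom_carrier[OF \<rho>s] by (auto simp: topspace_PSL_top)
    then show "\<forall>\<^sub>F n in sequentially. ?f (\<rho>s n) \<in> topspace ?P" by simp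
  qed simp
  then have "\<forall>\<^sub>F n in sequentially. ?f (\<rho>s n) \<in> U"
    using U O(2) by (intro limitinD) auto
  then show ?thesis by eventually_elim (use U \<rho>s in auto)
qed

text \<open>The converse of the previous lemma: the sets of representations whose values on the
  generators lift into balls of radius $1/(n+1)$ around fixed lifts form a countable neighbourhood base, so
  neighbourhoods are detected by sequences.\<close>

lemma Hom_nhd_sequentially:
  fixes X :: "('g \<Rightarrow> (complex^'n^'n) set) set"
  assumes s: "s ` {..<r} \<subseteq> carrier \<Gamma>" and \<rho>H: "\<rho> \<in> Hom \<Gamma> PSL"
    and seq: "\<And>\<rho>s. (\<And>n. \<rho>s n \<in> X)
      \<Longrightarrow> (\<And>x. x \<in> s ` {..<r} \<Longrightarrow> psl_tendsto (\<lambda>n. \<rho>s n x) (\<rho> x))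
      \<Longrightarrow> \<forall>\<^sub>F n in sequentially. \<rho>s n \<in> O'"
  shows "\<exists>W. openin (Hom_top \<Gamma> PSL PSL_top r s) W \<and> \<rho> \<in> W \<and> W \<inter> X \<subseteq> O'"
proof -
  let ?f = "\<lambda>\<rho>. \<lambda>i\<in>{..<r}. \<rho> (s i) :: (complex^'n^'n) set"
  have "\<forall>x\<in>carrier \<Gamma>. \<exists>B. det B = 1 \<and> \<rho> x = psl_proj B"
    using Hom_carrier[OF \<rho>H] by (metis PSL_cases)
  then obtain B where B: "\<And>x. x \<in> carrier \<Gamma> \<Longrightarrow> det (B x) = 1 \<and> \<rho> x = psl_proj (B x)"
    by metis
  define W where "W n = PiE {..<r} (\<lambda>i. psl_proj ` (ball (B (s i)) (inverse (real (Suc n))) \<inter> carrier SL))" for n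
  define N where "N n = ?f -` W n \<inter> Hom \<Gamma> PSL" for n
  have "openin (Hom_top \<Gamma> PSL PSL_top r s) (N n)" for n
    unfolding Hom_top_def openin_pullback_topology N_def W_def
    by (intro exI conjI refl) (auto simp: openin_PiE intro!: openin_psl_proj_image)
  moreover have "\<rho> \<in> N n" for n
    using s B \<rho>H by (auto simp: N_def W_def)
  moreover have "\<exists>n. N n \<inter> X \<subseteq> O'"
  proof (rule ccontr)
    assume "\<not> ?thesis"
    then have "\<forall>n. \<exists>\<sigma>. \<sigma> \<in> N n \<and> \<sigma> \<in> X \<and> \<sigma> \<notin> O'" by blast
    then obtain \<rho>s where \<rho>s: "\<And>n. \<rho>s n \<in> N n" "\<And>n. \<rho>s n \<in> X" "\<And>n. \<rho>s n \<notin> O'" by metis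
    have conv: "psl_tendsto (\<lambda>n. \<rho>s n x) (\<rho> x)" if x: "x \<in> s ` {..<r}" for x
    proof -
      from x obtain i where i: "i < r" "x = s i" by auto
      have "\<rho>s n x \<in> psl_proj ` (ball (B x) (inverse (real (Suc n))) \<inter> carrier SL)" for n
      proof -
        have "?f (\<rho>s n) \<in> W n" using \<rho>s(1)[of n] by (simp add: N_def)
        then have "?f (\<rho>s n) i \<in> psl_proj ` (ball (B x) (inverse (real (Suc n))) \<inter> carrier SL)"
          using i unfolding W_def by (auto dest!: PiE_mem)
        then show ?thesis using i by simp
      qed
      then have "\<exists>A. \<rho>s n x = psl_proj A \<and> dist (B x) A < inverse (real (Suc n)) \<and> det A = 1" for n
        by (meson IntE image_iff in_carrier_SL mem_ball)
      then obtain A where A: "\<And>n. \<rho>s n x = psl_proj (A n)" "\<And>n. dist (B x) (A n) < inverse (real (Suc n))"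
        "\<And>n. det (A n) = 1" by metis
      have "dist (A n) (B x) \<le> inverse (real (Suc n))" for n
        using A(2)[of n] by (simp only: dist_commute less_imp_le)
      then have "(\<lambda>n. dist (A n) (B x)) \<longlonglongrightarrow> 0"
        by (intro tendsto_sandwich[OF _ _ tendsto_const LIMSEQ_inverse_real_of_nat] always_eventually)
          simp_all
      then have lim: "A \<longlonglongrightarrow> B x" by (rule iffD2[OF tendsto_dist_iff])
      have x': "x \<in> carrier \<Gamma>" using x s by blast
      show ?thesis
        unfolding psl_tendsto_def
      proof (intro exI conjI allI)
        show "det (A n) = 1" "\<rho>s n x = psl_proj (A n)" for n by (fact A)+
        show "det (B x) = 1" "\<rho> x = psl_proj (B x)" using B[OF x'] by blast+
        show "A \<longlonglongrightarrow> B x" by (fact lim)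
      qed
    qed
    have "\<forall>\<^sub>F n in sequentially. \<rho>s n \<in> O'" by (rule seq[OF \<rho>s(2) conv])
    with \<rho>s(3) show False by simp
  qed
  ultimately show ?thesis by blast
qed

lemma openin_Hom_sequentially:
  fixes X :: "('g \<Rightarrow> (complex^'n^'n) set) set"
  assumes s: "s ` {..<r} \<subseteq> carrier \<Gamma>" and X: "X \<subseteq> Hom \<Gamma> PSL" and O: "O' \<subseteq> X"
    and seq: "\<And>\<rho>s \<rho>. (\<And>n. \<rho>s n \<in> X) \<Longrightarrow> \<rho> \<in> O'
      \<Longrightarrow> (\<And>x. x \<in> s ` {..<r} \<Longrightarrow> psl_tendsto (\<lambda>n. \<rho>s n x) (\<rho> x))
      \<Longrightarrow> \<forall>\<^sub>F n in sequentially. \<rho>s n \<in> O'"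
  shows "openin (subtopology (Hom_top \<Gamma> PSL PSL_top r s) X) O'"
proof (subst openin_subopen, intro ballI)
  fix \<rho> assume \<rho>: "\<rho> \<in> O'"
  then have "\<rho> \<in> Hom \<Gamma> PSL" using O X by blast
  from Hom_nhd_sequentially[OF s this seq[OF _ \<rho>]]
  obtain W where "openin (Hom_top \<Gamma> PSL PSL_top r s) W" "\<rho> \<in> W" "W \<inter> X \<subseteq> O'" by blast
  then have "openin (subtopology (Hom_top \<Gamma> PSL PSL_top r s) X) (W \<inter> X)" "\<rho> \<in> W \<inter> X" "W \<inter> X \<subseteq> O'"
    using \<rho> O by (auto simp only: openin_subtopology)
  then show "\<exists>T. openin (subtopology (Hom_top \<Gamma> PSL PSL_top r s) X) T \<and> \<rho> \<in> T \<and> T \<subseteq> O'"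
    by blast
qed

text \<open>The target being a subgroup does not change the topology on its representations, so source and
  target of \<open>phi\<close> are quotients of subspaces of a single space.\<close>

lemma Hom_top_subgroup:
  assumes s: "s ` {..<r} \<subseteq> carrier \<Gamma>" and K: "K \<subseteq> carrier G"
  shows "Hom_top \<Gamma> (G\<lparr>carrier := K\<rparr>) (subtopology T K) r s
    = subtopology (Hom_top \<Gamma> G T r s) {\<rho>. \<rho> ` carrier \<Gamma> \<subseteq> K}"
proof -
  let ?f = "\<lambda>\<rho>. \<lambda>i\<in>{..<r}. \<rho> (s i)"
  have H: "Hom \<Gamma> (G\<lparr>carrier := K\<rparr>) = Hom \<Gamma> G \<inter> {\<rho>. \<rho> ` carrier \<Gamma> \<subseteq> K}"
    using K by (auto simp: Hom_def hom_def)
  have P: "product_topology (\<lambda>_. subtopology T K) {..<r}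
      = subtopology (product_topology (\<lambda>_. T) {..<r}) (PiE {..<r} (\<lambda>_. K))"
    by (rule subtopology_product_topology[symmetric])
  have PiE: "?f \<rho> \<in> PiE {..<r} (\<lambda>_. K)" if "\<rho> ` carrier \<Gamma> \<subseteq> K" for \<rho>
    using that s by auto
  have eq: "?f -` (U \<inter> PiE {..<r} (\<lambda>_. K)) \<inter> (Hom \<Gamma> G \<inter> {\<rho>. \<rho> ` carrier \<Gamma> \<subseteq> K})
      = (?f -` U \<inter> Hom \<Gamma> G) \<inter> {\<rho>. \<rho> ` carrier \<Gamma> \<subseteq> K}" for U
    using PiE by (simp add: set_eq_iff) blast
  show ?thesis
    unfolding topology_eq
  proof (intro allI iffI)
    fix S assume "openin (Hom_top \<Gamma> (G\<lparr>carrier := K\<rparr>) (subtopology T K) r s) S"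
    then obtain U where "openin (product_topology (\<lambda>_. T) {..<r}) U"
      "S = ?f -` (U \<inter> PiE {..<r} (\<lambda>_. K)) \<inter> (Hom \<Gamma> G \<inter> {\<rho>. \<rho> ` carrier \<Gamma> \<subseteq> K})"
      unfolding Hom_top_def openin_pullback_topology H P openin_subtopology by blast
    then show "openin (subtopology (Hom_top \<Gamma> G T r s) {\<rho>. \<rho> ` carrier \<Gamma> \<subseteq> K}) S"
      unfolding eq Hom_top_def openin_subtopology openin_pullback_topology by blast
  next
    fix S assume "openin (subtopology (Hom_top \<Gamma> G T r s) {\<rho>. \<rho> ` carrier \<Gamma> \<subseteq> K}) S"
    then obtain U where "openin (product_topology (\<lambda>_. T) {..<r}) U"
      "S = (?f -` U \<inter> Hom \<Gamma> G) \<inter> {\<rho>. \<rho> ` carrier \<Gamma> \<subseteq> K}"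
      unfolding Hom_top_def openin_pullback_topology openin_subtopology by blast
    then show "openin (Hom_top \<Gamma> (G\<lparr>carrier := K\<rparr>) (subtopology T K) r s) S"
      unfolding eq[symmetric] Hom_top_def openin_pullback_topology H P openin_subtopology by blast
  qed
qed

section \<open>Conjugation of representations\<close>

text \<open>Conjugating a parabolic subgroup moves its flag.\<close>

lemma irreducible_subgroup_conj:
  fixes H :: "(complex^'n^'n) set set"
  assumes g: "g \<in> carrier PSL" and H: "H \<subseteq> carrier PSL" and irr: "irreducible_subgroup H"
  shows "irreducible_subgroup ((\<lambda>x. g \<otimes>\<^bsub>PSL\<^esub> x \<otimes>\<^bsub>PSL\<^esub> inv\<^bsub>PSL\<^esub> g) ` H)"
proof (rule ccontr)
  interpret P: group "PSL :: (complex^'n^'n) set monoid" by (rule group_PSL)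
  let ?c = "\<lambda>x. g \<otimes>\<^bsub>PSL\<^esub> x \<otimes>\<^bsub>PSL\<^esub> inv\<^bsub>PSL\<^esub> g"
  assume "\<not> irreducible_subgroup (?c ` H)"
  then obtain P where par: "parabolic P" and ne: "P \<noteq> carrier PSL" and sub: "?c ` H \<subseteq> P"
    unfolding irreducible_subgroup_def by blast
  from par obtain F where F: "\<forall>V\<in>F. vec.subspace V" "chain_subset F"
    and P_def: "P = psl_proj ` {A \<in> carrier SL. \<forall>V\<in>F. (*v) A ` V = V}"
    unfolding parabolic_def by (elim exE conjE)
  obtain A where A: "det A = 1" "g = psl_proj A" using g by (rule PSL_cases)
  let ?B = "matrix_inv A"
  have AB: "A ** ?B = mat 1" "?B ** A = mat 1" using A matrix_inv_det_nonzero[of A] by simp_all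
  define F' where "F' = (\<lambda>V. (*v) ?B ` V) ` F"
  define P' where "P' = psl_proj ` {C \<in> carrier SL. \<forall>V\<in>F'. (*v) C ` V = V}"
  have "parabolic P'"
    unfolding parabolic_def
  proof (intro exI conjI)
    show "P' = psl_proj ` {C \<in> carrier SL. \<forall>V\<in>F'. (*v) C ` V = V}" by (rule P'_def)
    show "\<forall>V\<in>F'. vec.subspace V"
      using F(1) unfolding F'_def
      by (auto intro!: vec.linear_subspace_image matrix_vector_mul_linear_gen)
    show "chain_subset F'"
      unfolding F'_def chain_subset_def
    proof (intro ballI, elim imageE)
      fix X Y V W
      assume "V \<in> F" "W \<in> F" and XY: "X = (*v) ?B ` V" "Y = (*v) ?B ` W"
      then have "V \<subseteq> W \<or> W \<subseteq> V" using F(2) by (simp add: chain_subset_def)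
      then show "X \<subseteq> Y \<or> Y \<subseteq> X" unfolding XY by (elim disjE) (simp_all add: image_mono)
    qed
  qed
  have stab: "(\<forall>V\<in>F'. (*v) C ` V = V) \<longleftrightarrow> (\<forall>V\<in>F. (*v) (A ** C ** ?B) ` V = V)" for C
  proof -
    have "(*v) C ` ((*v) ?B ` V) = (*v) ?B ` V \<longleftrightarrow> (*v) (A ** C ** ?B) ` V = V" for V
    proof
      assume "(*v) C ` ((*v) ?B ` V) = (*v) ?B ` V"
      then have "(*v) A ` ((*v) C ` ((*v) ?B ` V)) = (*v) A ` ((*v) ?B ` V)" by simp
      then show "(*v) (A ** C ** ?B) ` V = V"
        by (simp add: image_image matrix_vector_mul_assoc AB matrix_mul_assoc)
    next
      assume "(*v) (A ** C ** ?B) ` V = V"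
      then have "(*v) ?B ` ((*v) (A ** C ** ?B) ` V) = (*v) ?B ` V" by simp
      then show "(*v) C ` ((*v) ?B ` V) = (*v) ?B ` V"
        by (simp add: image_image matrix_vector_mul_assoc AB matrix_mul_assoc)
    qed
    then show ?thesis by (simp add: F'_def)
  qed
  have conj: "?c (psl_proj C) = psl_proj (A ** C ** ?B)" if "det C = 1" for C
    using that A by (simp add: psl_proj_mult psl_proj_inv det_mul det_matrix_inv)
  have mem: "x \<in> P'" if x: "x \<in> carrier PSL" "?c x \<in> P" for x
  proof -
    obtain D where D: "det D = 1" "\<forall>V\<in>F. (*v) D ` V = V" "?c x = psl_proj D"
      using x(2) by (auto simp: P_def)
    let ?C = "?B ** D ** A"
    have C: "det ?C = 1" using A D by (simp add: det_mul det_matrix_inv)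
    have "A ** ?C ** ?B = (A ** ?B) ** D ** (A ** ?B)" by (simp only: matrix_mul_assoc)
    then have ACB: "A ** ?C ** ?B = D" by (simp add: AB)
    then have "?c (psl_proj ?C) = ?c x" using conj[OF C] D by simp
    then have "psl_proj ?C = x"
      using g x(1) psl_proj_in_PSL[OF C] by simp
    moreover have "\<forall>V\<in>F'. (*v) ?C ` V = V" using stab[of ?C] D(2) ACB by simp
    ultimately show ?thesis using C unfolding P'_def by auto
  qed
  have "H \<subseteq> P'" using mem H sub by blast
  moreover have "P' \<noteq> carrier PSL"
  proof
    assume eq: "P' = carrier PSL"
    have "carrier PSL \<subseteq> P"
    proof
      fix y :: "(complex^'n^'n) set" assume y: "y \<in> carrier PSL"
      define x where "x = inv\<^bsub>PSL\<^esub> g \<otimes>\<^bsub>PSL\<^esub> y \<otimes>\<^bsub>PSL\<^esub> g"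
      have x: "x \<in> carrier PSL" using g y by (simp add: x_def)
      have cx: "?c x = y"
        using g y by (simp add: x_def P.m_assoc) (simp add: P.m_assoc[symmetric])
      obtain C where C: "det C = 1" "\<forall>V\<in>F'. (*v) C ` V = V" "x = psl_proj C"
        using x unfolding eq[symmetric] P'_def by auto
      then have "y = psl_proj (A ** C ** ?B)" "det (A ** C ** ?B) = 1" "\<forall>V\<in>F. (*v) (A ** C ** ?B) ` V = V"
        using cx conj[of C] stab[of C] A by (simp_all add: det_mul det_matrix_inv)
      then show "y \<in> P" unfolding P_def by auto
    qed
    moreover have "P \<subseteq> carrier PSL" unfolding P_def by (auto intro: psl_proj_in_PSL)
    ultimately show False using ne by blast
  qed
  ultimately show False using irr \<open>parabolic P'\<close> unfolding irreducible_subgroup_def by blast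
qed

lemma conjugate_rep_apply:
  "x \<in> carrier \<Gamma> \<Longrightarrow> conjugate_rep \<Gamma> G g \<rho> x = g \<otimes>\<^bsub>G\<^esub> \<rho> x \<otimes>\<^bsub>G\<^esub> inv\<^bsub>G\<^esub> g"
  by (simp add: conjugate_rep_def)

context group
begin

lemma conjugate_rep_Hom:
  assumes "group \<Gamma>" "\<rho> \<in> Hom \<Gamma> G" "g \<in> carrier G"
  shows "conjugate_rep \<Gamma> G g \<rho> \<in> Hom \<Gamma> G"
proof -
  have "conjugate_rep \<Gamma> G g \<rho> \<in> hom \<Gamma> G"
  proof (rule homI)
    show "conjugate_rep \<Gamma> G g \<rho> x \<in> carrier G" if "x \<in> carrier \<Gamma>" for x
      using that assms by (simp add: conjugate_rep_def Hom_carrier)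
    fix x y assume "x \<in> carrier \<Gamma>" "y \<in> carrier \<Gamma>"
    then show "conjugate_rep \<Gamma> G g \<rho> (x \<otimes>\<^bsub>\<Gamma>\<^esub> y)
        = conjugate_rep \<Gamma> G g \<rho> x \<otimes> conjugate_rep \<Gamma> G g \<rho> y"
      using assms by (simp add: conjugate_rep_def Hom_carrier Hom_mult m_assoc inv_solve_left
          group.is_monoid monoid.m_closed) 
  qed
  then show ?thesis by (simp add: Hom_def conjugate_rep_def)
qed

lemma conjugate_rep_mult:
  assumes "\<rho> \<in> Hom \<Gamma> G" "g \<in> carrier G" "h \<in> carrier G"
  shows "conjugate_rep \<Gamma> G h (conjugate_rep \<Gamma> G g \<rho>) = conjugate_rep \<Gamma> G (h \<otimes> g) \<rho>"
  using assms by (auto simp: conjugate_rep_def Hom_carrier inv_mult_group m_assoc)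

lemma conjugate_rep_one: "\<rho> \<in> Hom \<Gamma> G \<Longrightarrow> conjugate_rep \<Gamma> G \<one> \<rho> = \<rho>"
  by (rule ext) (auto simp: conjugate_rep_def Hom_def hom_def extensional_def Pi_iff)

lemma conj_class_eq_iff:
  assumes K: "subgroup K G" and \<rho>: "\<rho> \<in> Hom \<Gamma> G" and \<sigma>: "\<sigma> \<in> Hom \<Gamma> G"
  shows "conj_class \<Gamma> G K \<rho> = conj_class \<Gamma> G K \<sigma> \<longleftrightarrow> (\<exists>g\<in>K. \<sigma> = conjugate_rep \<Gamma> G g \<rho>)"
proof
  note Kc = subgroup.mem_carrier[OF K]
  {
    assume "conj_class \<Gamma> G K \<rho> = conj_class \<Gamma> G K \<sigma>"
    moreover have "\<sigma> \<in> conj_class \<Gamma> G K \<sigma>"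
      unfolding conj_class_def using conjugate_rep_one[OF \<sigma>] subgroup.one_closed[OF K]
      by (metis image_iff)
    ultimately show "\<exists>g\<in>K. \<sigma> = conjugate_rep \<Gamma> G g \<rho>" by (auto simp: conj_class_def)
  }
  assume "\<exists>g\<in>K. \<sigma> = conjugate_rep \<Gamma> G g \<rho>"
  then obtain g where g: "g \<in> K" "\<sigma> = conjugate_rep \<Gamma> G g \<rho>" by blast
  show "conj_class \<Gamma> G K \<rho> = conj_class \<Gamma> G K \<sigma>"
  proof (intro equalityI subsetI)
    fix \<tau> assume "\<tau> \<in> conj_class \<Gamma> G K \<rho>"
    then obtain h where h: "h \<in> K" "\<tau> = conjugate_rep \<Gamma> G h \<rho>" by (auto simp: conj_class_def)
    then have "\<tau> = conjugate_rep \<Gamma> G (h \<otimes> inv g) \<sigma>"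
      using g Kc \<rho> by (simp add: conjugate_rep_mult m_assoc)
    moreover have "h \<otimes> inv g \<in> K"
      using g h K by (simp add: subgroup.m_closed subgroup.m_inv_closed)
    ultimately show "\<tau> \<in> conj_class \<Gamma> G K \<sigma>" by (auto simp: conj_class_def)
  next
    fix \<tau> assume "\<tau> \<in> conj_class \<Gamma> G K \<sigma>"
    then obtain h where h: "h \<in> K" "\<tau> = conjugate_rep \<Gamma> G h \<sigma>" by (auto simp: conj_class_def)
    then have "\<tau> = conjugate_rep \<Gamma> G (h \<otimes> g) \<rho>"
      using g Kc \<rho> by (simp add: conjugate_rep_mult)
    moreover have "h \<otimes> g \<in> K" using g h K by (simp add: subgroup.m_closed)
    ultimately show "\<tau> \<in> conj_class \<Gamma> G K \<rho>" by (auto simp: conj_class_def)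
  qed
qed

end

lemma conjugate_rep_Homi:
  fixes \<rho> :: "'g \<Rightarrow> (complex^'n^'n) set"
  assumes "group \<Gamma>" "\<rho> \<in> Homi_PSL \<Gamma>" "g \<in> carrier PSL"
  shows "conjugate_rep \<Gamma> PSL g \<rho> \<in> Homi_PSL \<Gamma>"
proof -
  have \<rho>: "\<rho> \<in> Hom \<Gamma> PSL" "irreducible_subgroup (\<rho> ` carrier \<Gamma>)"
    using assms(2) by (auto simp: Homi_PSL_def)
  have "conjugate_rep \<Gamma> PSL g \<rho> ` carrier \<Gamma> = (\<lambda>x. g \<otimes>\<^bsub>PSL\<^esub> x \<otimes>\<^bsub>PSL\<^esub> inv\<^bsub>PSL\<^esub> g) ` (\<rho> ` carrier \<Gamma>)"
    by (auto simp: conjugate_rep_def)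
  moreover have "\<rho> ` carrier \<Gamma> \<subseteq> carrier PSL" using Hom_carrier[OF \<rho>(1)] by auto
  ultimately show ?thesis
    using irreducible_subgroup_conj[OF assms(3) _ \<rho>(2)]
      group.conjugate_rep_Hom[OF group_PSL assms(1) \<rho>(1) assms(3)]
    by (simp add: Homi_PSL_def)
qed

lemma psl_tendsto_conj:
  assumes "g \<in> carrier PSL" "psl_tendsto X Y"
  shows "psl_tendsto (\<lambda>n. g \<otimes>\<^bsub>PSL\<^esub> X n \<otimes>\<^bsub>PSL\<^esub> inv\<^bsub>PSL\<^esub> g) (g \<otimes>\<^bsub>PSL\<^esub> Y \<otimes>\<^bsub>PSL\<^esub> inv\<^bsub>PSL\<^esub> g)"
  using assms by (intro psl_tendsto_mult psl_tendsto_const group.inv_closed[OF group_PSL])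

section \<open>Translation-shaped matrices and \<open>DM\<close>\<close>

text \<open>For prime \<open>p\<close> every nonzero \<open>k\<close> generates $\mathbb{Z}/p$.\<close>

lemma mod_ring_translate_induct:
  fixes k :: "'p::prime_card mod_ring"
  assumes "k \<noteq> 0" "P a" "\<And>i. P i \<Longrightarrow> P (i + k)"
  shows "P b"
proof -
  obtain n where n: "(b - a) / k = of_nat n" using surj_of_nat_mod_ring by blast
  have "P (a + of_nat m * k)" for m
  proof (induction m)
    case (Suc m)
    from assms(3)[OF this] show ?case by (simp add: algebra_simps)
  qed (use assms in simp)
  moreover have "a + of_nat n * k = b" using assms(1) by (simp add: n[symmetric])
  ultimately show ?thesis by metis
qed

text \<open>The powers of \<open>M_c\<close> times diagonal matrices have this shape, with \<open>k\<close> the exponent.\<close>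

definition shift_shaped :: "'p::prime_card mod_ring \<Rightarrow> complex^('p mod_ring)^('p mod_ring) \<Rightarrow> bool" where
  "shift_shaped k A \<longleftrightarrow> (\<forall>i j. A $ i $ j \<noteq> 0 \<longrightarrow> i = j + k)"

lemma shift_shapedD: "shift_shaped k A \<Longrightarrow> A $ i $ j \<noteq> 0 \<Longrightarrow> i = j + k"
  by (simp add: shift_shaped_def)

lemma shift_shaped_mult_nth:
  assumes "shift_shaped k A"
  shows "(A ** B) $ i $ j = A $ i $ (i - k) * B $ (i - k) $ j"
proof -
  have "(A ** B) $ i $ j = (\<Sum>m\<in>UNIV. A $ i $ m * B $ m $ j)"
    by (simp add: matrix_matrix_mult_def)
  also have "\<dots> = (\<Sum>m\<in>{i - k}. A $ i $ m * B $ m $ j)"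
    by (rule sum.mono_neutral_right) (use shift_shapedD[OF assms] in force)+
  finally show ?thesis by simp
qed

lemma mult_shift_shaped_nth:
  assumes "shift_shaped k B"
  shows "(A ** B) $ i $ j = A $ i $ (j + k) * B $ (j + k) $ j"
proof -
  have "(A ** B) $ i $ j = (\<Sum>m\<in>UNIV. A $ i $ m * B $ m $ j)"
    by (simp add: matrix_matrix_mult_def)
  also have "\<dots> = (\<Sum>m\<in>{j + k}. A $ i $ m * B $ m $ j)"
    by (rule sum.mono_neutral_right) (use shift_shapedD[OF assms] in force)+
  finally show ?thesis by simp
qed

lemma shift_shaped_mult:
  assumes "shift_shaped k A" "shift_shaped l B"
  shows "shift_shaped (k + l) (A ** B)"
  unfolding shift_shaped_def
proof (intro allI impI)
  fix i j assume "(A ** B) $ i $ j \<noteq> 0"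
  then have "B $ (i - k) $ j \<noteq> 0" by (simp add: shift_shaped_mult_nth[OF assms(1)])
  from shift_shapedD[OF assms(2) this] show "i = j + (k + l)" by (simp add: algebra_simps)
qed

text \<open>Invertibility leaves no room for a zero on the only admissible diagonal.\<close>

lemma shift_shaped_nonzero:
  assumes "shift_shaped k A" "det A \<noteq> 0"
  shows "A $ (j + k) $ j \<noteq> 0"
proof -
  have "(matrix_inv A ** A) $ j $ j = 1"
    using matrix_inv_det_nonzero(2)[OF assms(2)] by (simp add: mat_def)
  then show ?thesis by (auto simp: mult_shift_shaped_nth[OF assms(1)])
qed

lemma shift_shaped_unique:
  assumes "shift_shaped k A" "shift_shaped l A" "det A \<noteq> 0"
  shows "k = l"
  using shift_shapedD[OF assms(2) shift_shaped_nonzero[OF assms(1,3)], of 0] by simp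

lemma shift_shaped_matrix_inv:
  assumes "shift_shaped k A" "det A \<noteq> 0"
  shows "shift_shaped (- k) (matrix_inv A)"
  unfolding shift_shaped_def
proof (intro allI impI)
  fix i m assume "matrix_inv A $ i $ m \<noteq> 0"
  then have "(matrix_inv A ** A) $ i $ (m - k) \<noteq> 0"
    using shift_shaped_nonzero[OF assms, of "m - k"] by (simp add: mult_shift_shaped_nth[OF assms(1)])
  then show "i = m + - k"
    by (simp add: matrix_inv_det_nonzero(2)[OF assms(2)] mat_def split: if_splits)
qed

lemma shift_shaped_scale: "shift_shaped k A \<Longrightarrow> shift_shaped k (mat c ** A)"
  by (auto simp: shift_shaped_def mat_mult_nth)

lemma shift_shaped_mat: "shift_shaped 0 (mat c)"
  by (auto simp: shift_shaped_def mat_def)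

text \<open>Existence of one lift of the given shape suffices: two lifts differ by a scalar, which preserves
  the shape (\<open>psl_shift_lift\<close>).\<close>

definition psl_shift :: "'p::prime_card mod_ring \<Rightarrow> (complex^('p mod_ring)^('p mod_ring)) set \<Rightarrow> bool" where
  "psl_shift k X \<longleftrightarrow> (\<exists>A. det A = 1 \<and> X = psl_proj A \<and> shift_shaped k A)"

lemma psl_shiftI: "det A = 1 \<Longrightarrow> shift_shaped k A \<Longrightarrow> psl_shift k (psl_proj A)"
  by (auto simp: psl_shift_def)

lemma psl_shift_lift:
  assumes "psl_shift k (psl_proj A)" "det A = 1"
  shows "shift_shaped k A"
proof -
  obtain B where B: "det B = 1" "psl_proj A = psl_proj B" "shift_shaped k B"
    using assms(1) by (auto simp: psl_shift_def)
  then obtain c where "A = mat c ** B" using assms(2) by (auto simp: psl_proj_eq_iff)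
  with B show ?thesis by (simp add: shift_shaped_scale)
qed

lemma psl_shift_carrier: "psl_shift k X \<Longrightarrow> X \<in> carrier PSL"
  by (auto simp: psl_shift_def psl_proj_in_PSL)

lemma psl_shift_unique: "psl_shift k X \<Longrightarrow> psl_shift l X \<Longrightarrow> k = l"
  by (metis psl_shift_def psl_shift_lift shift_shaped_unique zero_neq_one)

lemma psl_shift_mult: "psl_shift k X \<Longrightarrow> psl_shift l Y \<Longrightarrow> psl_shift (k + l) (X \<otimes>\<^bsub>PSL\<^esub> Y)"
  unfolding psl_shift_def using shift_shaped_mult by (metis det_mul mult_1 psl_proj_mult)

lemma psl_shift_inv: "psl_shift k X \<Longrightarrow> psl_shift (- k) (inv\<^bsub>PSL\<^esub> X)"
  unfolding psl_shift_def using shift_shaped_matrix_inv by (metis det_matrix_inv psl_proj_inv zero_neq_one)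

lemma psl_shift_one: "psl_shift 0 \<one>\<^bsub>PSL\<^esub>"
  using psl_shiftI[OF _ shift_shaped_mat, of 1] by (simp add: psl_proj_one)

lemma psl_shift_conj:
  assumes "psl_shift l g" "psl_shift k X"
  shows "psl_shift k (g \<otimes>\<^bsub>PSL\<^esub> X \<otimes>\<^bsub>PSL\<^esub> inv\<^bsub>PSL\<^esub> g)"
  using psl_shift_mult[OF psl_shift_mult[OF assms] psl_shift_inv[OF assms(1)]] by simp

lemma Dbar_iff: "X \<in> Dbar \<longleftrightarrow> psl_shift 0 X"
  by (auto simp: Dbar_def psl_shift_def shift_shaped_def)

text \<open>Up to scalars these are the powers of \<open>M_c\<close>; closing the set under scalars makes the case
  distinction between \<open>p = 2\<close> and odd \<open>p\<close> disappear.\<close>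

definition shift_matrix :: "'p::prime_card mod_ring \<Rightarrow> complex \<Rightarrow> complex^('p mod_ring)^('p mod_ring)" where
  "shift_matrix k c = (\<chi> i j. if i = j + k then c else 0)"

lemma shift_shaped_shift_matrix: "shift_shaped k (shift_matrix k c)"
  by (simp add: shift_shaped_def shift_matrix_def)

lemma shift_matrix_mult: "shift_matrix k c ** shift_matrix l d = shift_matrix (k + l) (c * d)"
  unfolding vec_eq_iff shift_shaped_mult_nth[OF shift_shaped_shift_matrix]
  by (auto simp: shift_matrix_def algebra_simps)

lemma shift_matrix_one: "shift_matrix 0 1 = mat 1"
  by (auto simp: shift_matrix_def mat_def vec_eq_iff)

lemma cyc_shift_matrix:
  fixes X :: "(complex^('p::prime_card mod_ring)^('p mod_ring)) set"
  assumes "X \<in> cyc"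
  shows "\<exists>k c. det (shift_matrix k c) = 1 \<and> X = psl_proj (shift_matrix k c)"
  using assms unfolding cyc_def
proof (induction rule: generate.induct)
  case one
  have "det (shift_matrix 0 1) = 1" "\<one>\<^bsub>PSL\<^esub> = psl_proj (shift_matrix 0 1)"
    by (simp_all add: shift_matrix_one psl_proj_one)
  then show ?case by blast
next
  case (incl h)
  have "(M_c :: complex^('p mod_ring)^('p mod_ring)) = shift_matrix 1 (if CARD('p) = 2 then \<i> else 1)"
    by (auto simp: M_c_def shift_matrix_def vec_eq_iff)
  moreover have "det (M_c :: complex^('p mod_ring)^('p mod_ring)) = 1" using M_c_in_SL by simp
  ultimately show ?case using incl by (metis singletonD)
next
  case (inv h)
  define c :: complex where "c = (if CARD('p) = 2 then \<i> else 1)"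
  have M: "(M_c :: complex^('p mod_ring)^('p mod_ring)) = shift_matrix 1 c"
    by (auto simp: M_c_def shift_matrix_def vec_eq_iff c_def)
  let ?N = "shift_matrix (-1) (inverse c) :: complex^('p mod_ring)^('p mod_ring)"
  have dM: "det (M_c :: complex^('p mod_ring)^('p mod_ring)) = 1" using M_c_in_SL by simp
  have MN: "M_c ** ?N = mat 1"
    unfolding M shift_matrix_mult by (simp add: c_def shift_matrix_one)
  have "det ?N = 1" using dM arg_cong[OF MN, of det] by (simp only: det_mul det_I mult_1)
  moreover have "matrix_inv M_c = ?N"
  proof -
    have "matrix_inv M_c ** (M_c ** ?N) = ?N"
      using dM by (simp add: matrix_mul_assoc matrix_inv_det_nonzero)
    then show ?thesis by (simp add: MN)
  qed
  ultimately show ?case using inv psl_proj_inv[OF dM] by (metis singletonD)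
next
  case (eng h1 h2)
  then obtain k c l d where "det (shift_matrix k c) = 1" "h1 = psl_proj (shift_matrix k c)"
    "det (shift_matrix l d) = 1" "h2 = psl_proj (shift_matrix l d)" by blast
  then have "det (shift_matrix (k + l) (c * d)) = 1" "h1 \<otimes>\<^bsub>PSL\<^esub> h2 = psl_proj (shift_matrix (k + l) (c * d))"
    by (simp_all add: psl_proj_mult shift_matrix_mult[symmetric] det_mul)
  then show ?case by blast
qed

lemma cyc_psl_shift: "X \<in> cyc \<Longrightarrow> \<exists>k. psl_shift k X"
  using cyc_shift_matrix psl_shiftI shift_shaped_shift_matrix by blast

text \<open>This is the triviality of $\overline{D} \cap \langle\overline{M_c}\rangle$.\<close>

lemma cyc_psl_shift_inj:
  assumes "X \<in> cyc" "Y \<in> cyc" "psl_shift k X" "psl_shift k Y"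
  shows "X = Y"
proof -
  have *: "\<exists>c. det (shift_matrix k c) = 1 \<and> Z = psl_proj (shift_matrix k c)"
    if Z: "Z \<in> cyc" "psl_shift k Z" for Z
  proof -
    obtain l c where "det (shift_matrix l c) = 1" "Z = psl_proj (shift_matrix l c)"
      using cyc_shift_matrix[OF Z(1)] by blast
    moreover from this have "psl_shift l Z" by (simp add: psl_shiftI shift_shaped_shift_matrix)
    then have "l = k" using Z(2) by (rule psl_shift_unique)
    ultimately show ?thesis by blast
  qed
  obtain c d where c: "det (shift_matrix k c) = 1" "X = psl_proj (shift_matrix k c)"
    and d: "det (shift_matrix k d) = 1" "Y = psl_proj (shift_matrix k d)"
    using * assms by metis
  have "d \<noteq> 0"
    using shift_shaped_nonzero[OF shift_shaped_shift_matrix, of k d 0] d by (auto simp: shift_matrix_def)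
  then have "shift_matrix k c = mat (c / d) ** shift_matrix k d"
    by (simp add: vec_eq_iff mat_mult_nth) (simp add: shift_matrix_def)
  with c d show ?thesis by (auto simp: psl_proj_eq_iff)
qed

lemma cyc_shift_exists: "\<exists>m\<in>cyc. psl_shift k m"
proof (rule mod_ring_translate_induct[of 1 _ 0])
  show "\<exists>m\<in>cyc. psl_shift 0 m"
    using psl_shift_one unfolding cyc_def by (blast intro: generate.one)
  have "psl_shift 1 (psl_proj M_c)"
    using M_c_in_SL by (intro psl_shiftI) (auto simp: shift_shaped_def M_c_def)
  moreover have "psl_proj M_c \<in> cyc" unfolding cyc_def by (rule generate.incl) simp
  ultimately show "\<exists>m\<in>cyc. psl_shift (i + 1) m" if "\<exists>m\<in>cyc. psl_shift i m" for i
    using that psl_shift_mult unfolding cyc_def by (metis generate.eng)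
qed simp

lemma DM_iff:
  fixes X :: "(complex^('p::prime_card mod_ring)^('p mod_ring)) set"
  shows "X \<in> DM \<longleftrightarrow> (\<exists>k. psl_shift k X)"
proof (intro iffI)
  assume "X \<in> DM"
  then obtain d m where "d \<in> Dbar" "m \<in> cyc" "X = d \<otimes>\<^bsub>PSL\<^esub> m"
    by (auto simp: DM_def set_mult_def)
  then show "\<exists>k. psl_shift k X"
    using cyc_psl_shift psl_shift_mult by (metis Dbar_iff)
next
  interpret P: group "PSL :: (complex^('p mod_ring)^('p mod_ring)) set monoid" by (rule group_PSL)
  assume "\<exists>k. psl_shift k X"
  then obtain k where k: "psl_shift k X" by blast
  obtain m where m: "m \<in> cyc" "psl_shift k m" using cyc_shift_exists by blast
  have "X \<otimes>\<^bsub>PSL\<^esub> inv\<^bsub>PSL\<^esub> m \<in> Dbar"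
    using psl_shift_mult[OF k psl_shift_inv[OF m(2)]] by (simp add: Dbar_iff)
  moreover have "X = X \<otimes>\<^bsub>PSL\<^esub> inv\<^bsub>PSL\<^esub> m \<otimes>\<^bsub>PSL\<^esub> m"
    using psl_shift_carrier[OF k] psl_shift_carrier[OF m(2)] by (simp add: P.m_assoc)
  ultimately show "X \<in> DM" using m(1) unfolding DM_def set_mult_def by blast
qed

text \<open>Existence and uniqueness of the factor in \<open>cyc\<close> both come from comparing exponents.\<close>

lemma semidirect_proj_eq_iff:
  assumes X: "X \<in> DM" and m: "m \<in> cyc" "psl_shift k m"
  shows "semidirect_proj X = m \<longleftrightarrow> psl_shift k X"
proof -
  interpret P: group "PSL :: (complex^('a mod_ring)^('a mod_ring)) set monoid" by (rule group_PSL)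
  obtain l where l: "psl_shift l X" using X by (auto simp: DM_iff)
  obtain m' where m': "m' \<in> cyc" "psl_shift l m'" using cyc_shift_exists by blast
  have "semidirect_proj X = m'"
    unfolding semidirect_proj_def
  proof (rule the_equality)
    have "X \<otimes>\<^bsub>PSL\<^esub> inv\<^bsub>PSL\<^esub> m' \<in> Dbar"
      using psl_shift_mult[OF l psl_shift_inv[OF m'(2)]] by (simp add: Dbar_iff)
    moreover have "X = X \<otimes>\<^bsub>PSL\<^esub> inv\<^bsub>PSL\<^esub> m' \<otimes>\<^bsub>PSL\<^esub> m'"
      using psl_shift_carrier[OF l] psl_shift_carrier[OF m'(2)] by (simp add: P.m_assoc)
    ultimately show "m' \<in> cyc \<and> (\<exists>d\<in>Dbar. X = d \<otimes>\<^bsub>PSL\<^esub> m')" using m'(1) by blast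
  next
    fix m'' assume "m'' \<in> cyc \<and> (\<exists>d\<in>Dbar. X = d \<otimes>\<^bsub>PSL\<^esub> m'')"
    then obtain d where d: "m'' \<in> cyc" "d \<in> Dbar" "X = d \<otimes>\<^bsub>PSL\<^esub> m''" by blast
    then obtain l'' where l'': "psl_shift l'' m''" using cyc_psl_shift by blast
    with d have "psl_shift (0 + l'') X" using psl_shift_mult by (metis Dbar_iff)
    then have "l'' = l" using psl_shift_unique[OF l] by simp
    then show "m'' = m'" using cyc_psl_shift_inj[OF d(1) m'(1)] l'' m'(2) by simp
  qed
  moreover have "m' = m \<longleftrightarrow> l = k"
    using cyc_psl_shift_inj[OF m'(1) m(1)] psl_shift_unique m(2) m'(2) by metis
  moreover have "l = k \<longleftrightarrow> psl_shift k X" using l psl_shift_unique by metis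
  ultimately show ?thesis by simp
qed

lemma subgroup_DM: "subgroup DM (PSL :: (complex^('p::prime_card mod_ring)^('p mod_ring)) set monoid)"
proof (rule group.subgroupI[OF group_PSL])
  show "DM \<noteq> ({} :: (complex^('p mod_ring)^('p mod_ring)) set set)"
    using iffD2[OF DM_iff, OF exI, OF psl_shift_one] by auto
qed (auto simp: DM_iff dest: psl_shift_carrier intro: psl_shift_mult psl_shift_inv)

lemma H_rep_iff:
  fixes \<rho> :: "'g \<Rightarrow> (complex^('p::prime_card mod_ring)^('p mod_ring)) set"
  assumes "\<And>x. x \<in> carrier \<Gamma> \<Longrightarrow> \<rho>bar x \<in> cyc \<and> psl_shift (\<kappa> x) (\<rho>bar x)"
  shows "\<rho> \<in> H_rep \<Gamma> \<rho>bar \<longleftrightarrow> \<rho> \<in> Homi_PSL \<Gamma> \<and> (\<forall>x\<in>carrier \<Gamma>. psl_shift (\<kappa> x) (\<rho> x))"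
proof -
  have "\<rho> x \<in> DM \<and> semidirect_proj (\<rho> x) = \<rho>bar x \<longleftrightarrow> psl_shift (\<kappa> x) (\<rho> x)"
    if x: "x \<in> carrier \<Gamma>" for x
  proof (cases "\<rho> x \<in> DM")
    case True
    then show ?thesis
      using semidirect_proj_eq_iff[OF True conjunct1[OF assms[OF x]] conjunct2[OF assms[OF x]]] by simp
  qed (auto simp: DM_iff)
  then have "(\<forall>x\<in>carrier \<Gamma>. \<rho> x \<in> DM \<and> semidirect_proj (\<rho> x) = \<rho>bar x)
      \<longleftrightarrow> (\<forall>x\<in>carrier \<Gamma>. psl_shift (\<kappa> x) (\<rho> x))" by (rule ball_cong[OF refl])
  then show ?thesis by (simp add: H_rep_def Homi_DM_def image_subset_iff ball_conj_distrib conj_assoc)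
qed

section \<open>Irreducibility separates the coordinates\<close>

text \<open>A transvection adding a nonzero coordinate of \<open>v\<close> to another one moves the line.\<close>

lemma line_stabilizer_proper:
  fixes v :: "complex^'n"
  assumes v: "v \<noteq> 0" and n: "CARD('n) \<ge> 2"
  shows "psl_proj ` {A \<in> carrier SL. \<forall>V\<in>{vec.span {v}}. (*v) A ` V = V}
    \<noteq> carrier (PSL :: (complex^'n^'n) set monoid)"
proof
  assume eq: "psl_proj ` {A \<in> carrier SL. \<forall>V\<in>{vec.span {v}}. (*v) A ` V = V}
    = carrier (PSL :: (complex^'n^'n) set monoid)"
  obtain i where i: "v $ i \<noteq> 0" using v by (auto simp: vec_eq_iff)
  have "\<exists>j. j \<noteq> i"
  proof (rule ccontr)
    assume "\<nexists>j. j \<noteq> i"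
    then have "(UNIV :: 'n set) = {i}" by auto
    then have "CARD('n) = card {i}" by (simp only:)
    with n show False by simp
  qed
  then obtain j where j: "j \<noteq> i" by blast
  let ?T = "transvection j i"
  have T: "det ?T = 1" using j by (rule det_transvection)
  then have "psl_proj ?T \<in> carrier PSL" by (rule psl_proj_in_PSL)
  then obtain B where B: "det B = 1" "(*v) B ` vec.span {v} = vec.span {v}" "psl_proj ?T = psl_proj B"
    unfolding eq[symmetric] by auto
  then obtain c where c: "?T = mat c ** B" using T by (auto simp: psl_proj_eq_iff)
  have "B *v v \<in> vec.span {v}" using B(2) vec.span_base[of v "{v}"] by blast
  then obtain t where t: "B *v v = t *s v" by (auto simp: vec.span_singleton)
  have "?T *v v = (c * t) *s v"
  proof -
    have "mat c *v y = c *s y" for y :: "complex^'n"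
      by (simp add: vec_eq_iff matrix_vector_mult_def mat_def if_distrib if_distribR cong: if_cong)
    then show ?thesis by (simp only: c matrix_vector_mul_assoc[symmetric] t vector_smult_assoc)
  qed
  then have e: "v $ m + (if m = j then v $ i else 0) = c * t * v $ m" for m
    unfolding transvection_mult_vec by (auto simp: vec_eq_iff axis_def dest!: spec[of _ m])
  have "c * t = 1" using e[of i] i j by simp
  with e[of j] i show False by simp
qed

text \<open>The vectors $A^m e_0$ are multiples of distinct basis vectors for $m < p$, and $A^p e_0$ is a
  multiple $c\,e_0$. For $\mu^p = c$ the sum of $\mu^{-m} A^m e_0$ over $m < p$ is an eigenvector,
  because \<open>A\<close> maps each term to $\mu$ times the next one, cyclically.\<close>

lemma shift_shaped_eigenvector:
  fixes A :: "complex^('p::prime_card mod_ring)^('p mod_ring)"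
  assumes A: "shift_shaped k A" "k \<noteq> 0" "det A \<noteq> 0"
  obtains v \<mu> where "v \<noteq> 0" "\<mu> \<noteq> 0" "A *v v = \<mu> *s v"
proof -
  define w where "w m = ((*v) A ^^ m) (axis 0 1)" for m
  have w0: "w 0 = axis 0 1" and wS: "w (Suc m) = A *v w m" for m by (simp_all add: w_def)
  have A_nth: "(A *v x) $ i = A $ i $ (i - k) * x $ (i - k)" for x i
  proof -
    have "(A *v x) $ i = (\<Sum>m\<in>UNIV. A $ i $ m * x $ m)"
      by (simp add: matrix_vector_mult_def)
    also have "\<dots> = (\<Sum>m\<in>{i - k}. A $ i $ m * x $ m)"
      by (rule sum.mono_neutral_right) (use shift_shapedD[OF A(1)] in force)+
    finally show ?thesis by simp
  qed
  have supp: "w m $ i \<noteq> 0 \<longleftrightarrow> i = of_nat m * k" for m i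
  proof (induction m arbitrary: i)
    case 0
    show ?case by (simp add: w0 axis_def)
  next
    case (Suc m)
    have "A $ i $ (i - k) \<noteq> 0" using shift_shaped_nonzero[OF A(1,3), of "i - k"] by simp
    then have "w (Suc m) $ i \<noteq> 0 \<longleftrightarrow> i - k = of_nat m * k"
      using Suc.IH[of "i - k"] by (simp add: wS A_nth)
    then show ?case by (simp add: algebra_simps)
  qed
  define p where "p = CARD('p)"
  have p: "p > 0" by (simp add: p_def)
  have pk: "of_nat p * k = 0" unfolding p_def by simp
  define c where "c = w p $ 0"
  have c0: "c \<noteq> 0" using supp[of p 0] pk by (simp add: c_def)
  have wp: "w p = c *s axis 0 1"
    using supp[of p] pk by (auto simp: vec_eq_iff axis_def c_def)
  define \<mu> where "\<mu> = exp (Ln c / of_nat p)"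
  have \<mu>: "\<mu> ^ p = c" "\<mu> \<noteq> 0"
    using c0 p by (simp_all add: \<mu>_def exp_of_nat_mult[symmetric])
  define g where "g m = (inverse \<mu> ^ m) *s w m" for m
  define v where "v = (\<Sum>m<p. g m)"
  have Ag: "A *v g m = \<mu> *s g (Suc m)" for m
    using \<mu>(2) by (simp add: g_def wS vector_scalar_commute vector_smult_assoc)
  have "g p = g 0"
    using \<mu> c0 by (simp add: g_def wp w0 vector_smult_assoc power_inverse)
  moreover have "(\<Sum>m<p. g (Suc m) - g m) = g p - g 0" by (rule sum_lessThan_telescope)
  ultimately have sh: "(\<Sum>m<p. g (Suc m)) = v" by (simp add: v_def sum_subtractf)
  have "A *v v = (\<Sum>m<p. A *v g m)"
    unfolding v_def by (rule vec.linear_sum[OF matrix_vector_mul_linear_gen])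
  also have "\<dots> = \<mu> *s v"
    by (simp add: Ag sh[symmetric] vec.scale_sum_right)
  finally have eig: "A *v v = \<mu> *s v" .
  have "g m $ 0 = 0" if "m \<in> {..<p} - {0}" for m
  proof -
    have "(of_nat m :: 'p mod_ring) \<noteq> 0"
      using that of_nat_0_mod_ring_dvd[where 'a='p, of m] dvd_imp_le[of "CARD('p)" m] by (auto simp: p_def)
    then show ?thesis using supp[of m 0] A(2) by (auto simp: g_def)
  qed
  then have "v $ 0 = (\<Sum>m\<in>{0}. g m $ 0)"
    unfolding v_def sum_component using p by (intro sum.mono_neutral_right) auto
  then have "v $ 0 \<noteq> 0" by (simp add: g_def w0 axis_def)
  then have "v \<noteq> 0" by auto
  from this \<mu>(2) eig show thesis by (rule that)
qed

text \<open>The exponents inherit the homomorphism property from any representation that realizes them.\<close>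

lemma psl_shift_hom:
  assumes "\<rho> \<in> Hom \<Gamma> PSL" "\<forall>x\<in>carrier \<Gamma>. psl_shift (\<kappa> x) (\<rho> x)" "group \<Gamma>"
  shows "x \<in> carrier \<Gamma> \<Longrightarrow> y \<in> carrier \<Gamma> \<Longrightarrow> \<kappa> (x \<otimes>\<^bsub>\<Gamma>\<^esub> y) = \<kappa> x + \<kappa> y"
    and "x \<in> carrier \<Gamma> \<Longrightarrow> \<kappa> (inv\<^bsub>\<Gamma>\<^esub> x) = - \<kappa> x"
    and "\<kappa> \<one>\<^bsub>\<Gamma>\<^esub> = 0"
proof -
  interpret \<Gamma>: group \<Gamma> by fact
  show "\<kappa> (x \<otimes>\<^bsub>\<Gamma>\<^esub> y) = \<kappa> x + \<kappa> y" if "x \<in> carrier \<Gamma>" "y \<in> carrier \<Gamma>"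
    using psl_shift_unique[OF bspec[OF assms(2), OF \<Gamma>.m_closed[OF that]]]
      psl_shift_mult[OF bspec[OF assms(2), OF that(1)] bspec[OF assms(2), OF that(2)]] Hom_mult[OF assms(1) that] by simp
  show "\<kappa> (inv\<^bsub>\<Gamma>\<^esub> x) = - \<kappa> x" if "x \<in> carrier \<Gamma>"
    using psl_shift_unique[OF bspec[OF assms(2), OF \<Gamma>.inv_closed[OF that]]]
      psl_shift_inv[OF bspec[OF assms(2), OF that]] Hom_inv[OF assms(1,3) that] by simp
  show "\<kappa> \<one>\<^bsub>\<Gamma>\<^esub> = 0"
    using psl_shift_unique[OF bspec[OF assms(2), OF \<Gamma>.one_closed]] psl_shift_one Hom_one[OF assms(1,3)] by simp
qed

text \<open>The image is generated by \<open>\<rho> \<gamma>\<close>, because every \<open>x\<close> agrees with a power of \<open>\<gamma>\<close> up to the kernel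
  of \<open>\<kappa>\<close>. It therefore fixes the line through an eigenvector of a lift of \<open>\<rho> \<gamma>\<close>.\<close>

lemma trivial_kernel_reducible:
  fixes \<rho> :: "'g \<Rightarrow> (complex^('p::prime_card mod_ring)^('p mod_ring)) set"
  assumes "group \<Gamma>" and \<rho>: "\<rho> \<in> Hom \<Gamma> PSL"
    and sh_all: "\<forall>x\<in>carrier \<Gamma>. psl_shift (\<kappa> x) (\<rho> x)"
    and \<gamma>: "\<gamma> \<in> carrier \<Gamma>" "\<kappa> \<gamma> \<noteq> 0"
    and triv: "\<forall>x\<in>carrier \<Gamma>. \<kappa> x = 0 \<longrightarrow> \<rho> x = \<one>\<^bsub>PSL\<^esub>"
  shows "\<not> irreducible_subgroup (\<rho> ` carrier \<Gamma>)"
proof -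
  interpret \<Gamma>: group \<Gamma> by fact
  interpret P: group "PSL :: (complex^('p mod_ring)^('p mod_ring)) set monoid" by (rule group_PSL)
  note sh = bspec[OF sh_all]
  note \<kappa> = psl_shift_hom[OF \<rho> sh_all assms(1)]
  obtain A where A: "det A = 1" "\<rho> \<gamma> = psl_proj A" "shift_shaped (\<kappa> \<gamma>) A"
    using sh[OF \<gamma>(1)] by (auto simp: psl_shift_def)
  obtain v \<mu> where v: "v \<noteq> 0" "\<mu> \<noteq> 0" "A *v v = \<mu> *s v"
    using shift_shaped_eigenvector[OF A(3) \<gamma>(2)] A(1) by (metis zero_neq_one)
  define L where "L = vec.span {v}"
  have AL: "(*v) A ` L = L"
  proof -
    have *: "A *v (t *s v) = (t * \<mu>) *s v" for t
      by (simp add: vector_scalar_commute v(3) vector_smult_assoc)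
    show ?thesis
    proof (intro equalityI subsetI)
      fix y assume "y \<in> (*v) A ` L"
      then show "y \<in> L" by (auto simp: L_def vec.span_singleton *)
    next
      fix y assume "y \<in> L"
      then obtain t where t: "y = t *s v" by (auto simp: L_def vec.span_singleton)
      then have "y = A *v ((t / \<mu>) *s v)" using v(2) by (simp add: *)
      moreover have "(t / \<mu>) *s v \<in> L" by (auto simp: L_def vec.span_singleton)
      ultimately show "y \<in> (*v) A ` L" by blast
    qed
  qed
  define Q where "Q X \<longleftrightarrow> (\<exists>B. det B = 1 \<and> X = psl_proj B \<and> (*v) B ` L = L)" for X
  have Qmult: "Q (X \<otimes>\<^bsub>PSL\<^esub> psl_proj A)" if "Q X" for X
  proof -
    obtain B where B: "det B = 1" "X = psl_proj B" "(*v) B ` L = L" using \<open>Q X\<close> by (auto simp: Q_def)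
    have "(*v) (B ** A) ` L = (*v) B ` ((*v) A ` L)"
      by (simp add: image_image matrix_vector_mul_assoc)
    then have "(*v) (B ** A) ` L = L" by (simp only: AL B(3))
    then show ?thesis
      unfolding Q_def using A B by (intro exI[of _ "B ** A"]) (simp add: det_mul psl_proj_mult)
  qed
  have all: "\<exists>y\<in>carrier \<Gamma>. \<kappa> y = a \<and> Q (\<rho> y)" for a
  proof (rule mod_ring_translate_induct[OF \<gamma>(2), of _ 0])
    have "(*v) (mat 1) ` L = L" by simp
    then have "Q \<one>\<^bsub>PSL\<^esub>" unfolding Q_def psl_proj_one[symmetric] by (intro exI[of _ "mat 1"]) simp
    then show "\<exists>y\<in>carrier \<Gamma>. \<kappa> y = 0 \<and> Q (\<rho> y)"
      using \<kappa>(3) Hom_one[OF \<rho> assms(1)] by (intro bexI[of _ "\<one>\<^bsub>\<Gamma>\<^esub>"]) auto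
    fix i assume "\<exists>y\<in>carrier \<Gamma>. \<kappa> y = i \<and> Q (\<rho> y)"
    then obtain y where y: "y \<in> carrier \<Gamma>" "\<kappa> y = i" "Q (\<rho> y)" by blast
    then have "Q (\<rho> (y \<otimes>\<^bsub>\<Gamma>\<^esub> \<gamma>))" "\<kappa> (y \<otimes>\<^bsub>\<Gamma>\<^esub> \<gamma>) = i + \<kappa> \<gamma>"
      using Qmult[OF y(3)] \<kappa>(1)[OF y(1) \<gamma>(1)] by (simp_all add: Hom_mult[OF \<rho> y(1) \<gamma>(1)] A(2))
    then show "\<exists>y\<in>carrier \<Gamma>. \<kappa> y = i + \<kappa> \<gamma> \<and> Q (\<rho> y)" using y(1) \<gamma>(1) by blast
  qed
  have "Q (\<rho> x)" if x: "x \<in> carrier \<Gamma>" for x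
  proof -
    obtain y where y: "y \<in> carrier \<Gamma>" "\<kappa> y = \<kappa> x" "Q (\<rho> y)" using all by blast
    have z: "x \<otimes>\<^bsub>\<Gamma>\<^esub> inv\<^bsub>\<Gamma>\<^esub> y \<in> carrier \<Gamma>" using x y by simp
    have "\<rho> (x \<otimes>\<^bsub>\<Gamma>\<^esub> inv\<^bsub>\<Gamma>\<^esub> y) = \<one>\<^bsub>PSL\<^esub>"
      using bspec[OF triv z] \<kappa>(1)[OF x \<Gamma>.inv_closed[OF y(1)]] \<kappa>(2)[OF y(1)] y(2) by simp
    then have "\<rho> x \<otimes>\<^bsub>PSL\<^esub> inv\<^bsub>PSL\<^esub> (\<rho> y) = \<one>\<^bsub>PSL\<^esub>"
      using x y by (simp add: Hom_mult[OF \<rho>] Hom_inv[OF \<rho> assms(1)])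
    then have "\<rho> x = \<rho> y"
      using Hom_carrier[OF \<rho> x] Hom_carrier[OF \<rho> y(1)] by (metis P.inv_equality P.inv_closed P.inv_inv)
    with y show ?thesis by simp
  qed
  moreover have "X \<in> psl_proj ` {B \<in> carrier SL. \<forall>V\<in>{L}. (*v) B ` V = V}" if "Q X" for X
    using that by (auto simp: Q_def)
  ultimately have "\<rho> ` carrier \<Gamma> \<subseteq> psl_proj ` {B \<in> carrier SL. \<forall>V\<in>{L}. (*v) B ` V = V}"
    by blast
  moreover have "parabolic (psl_proj ` {B \<in> carrier SL. \<forall>V\<in>{L}. (*v) B ` V = V})"
    unfolding parabolic_def
    by (rule exI[of _ "{L}"]) (auto simp: L_def chain_subset_def vec.subspace_span)
  moreover have "psl_proj ` {B \<in> carrier SL. \<forall>V\<in>{L}. (*v) B ` V = V}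
      \<noteq> carrier (PSL :: (complex^('p mod_ring)^('p mod_ring)) set monoid)"
    unfolding L_def using prime_card[where 'a='p]
    by (intro line_stabilizer_proper v(1)) (simp add: prime_ge_2_nat)
  ultimately show ?thesis unfolding irreducible_subgroup_def by blast
qed

text \<open>The pairs of coordinates on which $\ker\kappa$ acts by equal entries are permuted by the
  translation by \<open>\<kappa> \<gamma>\<close>, since conjugation by \<open>\<gamma>\<close> preserves $\ker\kappa$. If \<open>(i, j)\<close> is such a pair,
  then so are all its translates \<open>(b, b + (j - i))\<close>, and stepping by \<open>j - i\<close> makes all entries equal.\<close>

lemma irreducible_separates:
  fixes \<rho> :: "'g \<Rightarrow> (complex^('p::prime_card mod_ring)^('p mod_ring)) set"
  assumes "group \<Gamma>" and \<rho>: "\<rho> \<in> Homi_PSL \<Gamma>"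
    and sh_all: "\<forall>x\<in>carrier \<Gamma>. psl_shift (\<kappa> x) (\<rho> x)"
    and R_all: "\<forall>x\<in>carrier \<Gamma>. det (R x) = 1 \<and> \<rho> x = psl_proj (R x)"
    and \<gamma>: "\<gamma> \<in> carrier \<Gamma>" "\<kappa> \<gamma> \<noteq> 0"
    and ij: "i \<noteq> j"
  shows "\<exists>x\<in>carrier \<Gamma>. \<kappa> x = 0 \<and> R x $ i $ i \<noteq> R x $ j $ j"
proof (rule ccontr)
  interpret \<Gamma>: group \<Gamma> by fact
  assume "\<not> ?thesis"
  then have eq: "R x $ i $ i = R x $ j $ j" if "x \<in> carrier \<Gamma>" "\<kappa> x = 0" for x
    using that by blast
  have \<rho>H: "\<rho> \<in> Hom \<Gamma> PSL" using \<rho> by (simp add: Homi_PSL_def)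
  note sh = bspec[OF sh_all] and R = bspec[OF R_all]
  note \<kappa> = psl_shift_hom[OF \<rho>H sh_all assms(1)]
  have shR: "shift_shaped (\<kappa> x) (R x)" if "x \<in> carrier \<Gamma>" for x
    using psl_shift_lift[of "\<kappa> x" "R x"] sh[OF that] R[OF that] by simp
  let ?k = "\<kappa> \<gamma>"
  have trans: "\<forall>x\<in>carrier \<Gamma>. \<kappa> x = 0 \<longrightarrow> R x $ (i + m) $ (i + m) = R x $ (j + m) $ (j + m)" for m
  proof (rule mod_ring_translate_induct[of "- ?k"
        "\<lambda>m. \<forall>x\<in>carrier \<Gamma>. \<kappa> x = 0 \<longrightarrow> R x $ (i + m) $ (i + m) = R x $ (j + m) $ (j + m)" 0])
    fix m
    assume IH: "\<forall>x\<in>carrier \<Gamma>. \<kappa> x = 0 \<longrightarrow> R x $ (i + m) $ (i + m) = R x $ (j + m) $ (j + m)"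
    show "\<forall>x\<in>carrier \<Gamma>. \<kappa> x = 0 \<longrightarrow>
      R x $ (i + (m + - ?k)) $ (i + (m + - ?k)) = R x $ (j + (m + - ?k)) $ (j + (m + - ?k))"
    proof (intro ballI impI)
      fix x assume x: "x \<in> carrier \<Gamma>" "\<kappa> x = 0"
      define y where "y = \<gamma> \<otimes>\<^bsub>\<Gamma>\<^esub> x \<otimes>\<^bsub>\<Gamma>\<^esub> inv\<^bsub>\<Gamma>\<^esub> \<gamma>"
      have y: "y \<in> carrier \<Gamma>" using x \<gamma> by (simp add: y_def)
      have y\<gamma>: "y \<otimes>\<^bsub>\<Gamma>\<^esub> \<gamma> = \<gamma> \<otimes>\<^bsub>\<Gamma>\<^esub> x"
        using x \<gamma> by (simp add: y_def \<Gamma>.m_assoc)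
      have y0: "\<kappa> y = 0"
        using \<kappa>(1)[OF y \<gamma>(1)] \<kappa>(1)[OF \<gamma>(1) x(1)] x(2) unfolding y\<gamma> by simp
      have "psl_proj (R y ** R \<gamma>) = psl_proj (R \<gamma> ** R x)"
        using Hom_mult[OF \<rho>H y \<gamma>(1)] Hom_mult[OF \<rho>H \<gamma>(1) x(1)] R[OF x(1)] R[OF y] R[OF \<gamma>(1)]
        unfolding y\<gamma> by (simp add: psl_proj_mult)
      then obtain c where c: "R y ** R \<gamma> = mat c ** (R \<gamma> ** R x)"
        using R[OF x(1)] R[OF y] R[OF \<gamma>(1)] by (auto simp: psl_proj_eq_iff det_mul)
      \<comment> \<open>The scalar \<open>c\<close> appears because the lifts of \<open>y\<close>, \<open>\<gamma>\<close> and \<open>x\<close> are chosen independently.\<close>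
      have rel: "R y $ (a + ?k) $ (a + ?k) = c * R x $ a $ a" for a
      proof -
        have "(R y ** R \<gamma>) $ (a + ?k) $ a = (mat c ** (R \<gamma> ** R x)) $ (a + ?k) $ a" by (simp only: c)
        then have "R y $ (a + ?k) $ (a + ?k) * R \<gamma> $ (a + ?k) $ a
            = c * (R \<gamma> $ (a + ?k) $ a * R x $ a $ a)"
          by (simp add: mult_shift_shaped_nth[OF shR[OF \<gamma>(1)]] mat_mult_nth
              shift_shaped_mult_nth[OF shR[OF \<gamma>(1)], of "R x"])
        moreover have "R \<gamma> $ (a + ?k) $ a \<noteq> 0"
          using shift_shaped_nonzero[OF shR[OF \<gamma>(1)]] R[OF \<gamma>(1)] by simp
        ultimately show ?thesis by simp
      qed
      have "R y $ (0 + ?k) $ (0 + ?k) \<noteq> 0"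
        using shift_shaped_nonzero[OF shR[OF y], of ?k] R[OF y] y0 by simp
      then have c0: "c \<noteq> 0" using rel[of 0] by auto
      have "R y $ (i + m) $ (i + m) = R y $ (j + m) $ (j + m)" using IH y y0 by blast
      then have "c * R x $ (i + m - ?k) $ (i + m - ?k) = c * R x $ (j + m - ?k) $ (j + m - ?k)"
        using rel[of "i + m - ?k"] rel[of "j + m - ?k"] by simp
      then show "R x $ (i + (m + - ?k)) $ (i + (m + - ?k)) = R x $ (j + (m + - ?k)) $ (j + (m + - ?k))"
        using c0 by (simp add: algebra_simps)
    qed
  qed (use \<gamma> eq in auto)
  have "\<rho> x = \<one>\<^bsub>PSL\<^esub>" if x: "x \<in> carrier \<Gamma>" "\<kappa> x = 0" for x
  proof -
    have "R x $ a $ a = R x $ 0 $ 0" for a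
    proof (rule mod_ring_translate_induct[of "j - i" "\<lambda>a. R x $ a $ a = R x $ 0 $ 0" 0])
      fix b assume "R x $ b $ b = R x $ 0 $ 0"
      then show "R x $ (b + (j - i)) $ (b + (j - i)) = R x $ 0 $ 0"
        using trans[of "b - i"] x by (simp add: algebra_simps)
    qed (use ij in auto)
    moreover have "R x $ a $ b = 0" if "a \<noteq> b" for a b
      using shift_shapedD[OF shR[OF x(1)], of a b] that x(2) by auto
    ultimately have "R x $ a $ b = mat (R x $ 0 $ 0) $ a $ b" for a b
      by (cases "a = b") (simp_all add: mat_def)
    then have "R x = mat (R x $ 0 $ 0) ** mat 1"
      unfolding matrix_mul_rid vec_eq_iff by blast
    then have "psl_proj (R x) = psl_proj (mat 1)"
      using R[OF x(1)] psl_proj_eq_iff[of "R x" "mat 1"] by auto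
    then show ?thesis using R[OF x(1)] by (simp add: psl_proj_one)
  qed
  then have "\<forall>x\<in>carrier \<Gamma>. \<kappa> x = 0 \<longrightarrow> \<rho> x = \<one>\<^bsub>PSL\<^esub>" by blast
  from trivial_kernel_reducible[OF assms(1) \<rho>H sh_all \<gamma> this]
  show False using \<rho> by (simp add: Homi_PSL_def)
qed

section \<open>Rigidity of intertwiners\<close>

text \<open>Row \<open>i\<close> of \<open>u ** A\<close> is proportional to row \<open>i - k\<close> of \<open>u\<close>, written without a factor of
  proportionality. In this form the condition survives rescaling the rows of \<open>u\<close> and taking limits.\<close>

definition intertwines_rows :: "'p::prime_card mod_ring \<Rightarrow> complex^('p mod_ring)^('p mod_ring)
    \<Rightarrow> complex^('p mod_ring)^('p mod_ring) \<Rightarrow> bool" where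
  "intertwines_rows k u A \<longleftrightarrow>
     (\<forall>i a b. (u ** A) $ i $ a * u $ (i - k) $ b = (u ** A) $ i $ b * u $ (i - k) $ a)"

lemma intertwines_rowsI:
  assumes "shift_shaped k T" "u ** A = T ** u"
  shows "intertwines_rows k u A"
  by (simp add: intertwines_rows_def assms(2) shift_shaped_mult_nth[OF assms(1)] mult_ac)

lemma intertwines_rows_scale:
  assumes "intertwines_rows k u A"
  shows "intertwines_rows k (\<chi> i j. t i * u $ i $ j) A"
proof -
  have row: "((\<chi> i j. t i * u $ i $ j) ** A) $ i $ a = t i * (u ** A) $ i $ a" for i a
    by (simp add: matrix_matrix_mult_def sum_distrib_left mult_ac)
  show ?thesis
    unfolding intertwines_rows_def
  proof (intro allI)
    fix i a b
    have "(u ** A) $ i $ a * u $ (i - k) $ b = (u ** A) $ i $ b * u $ (i - k) $ a"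
      using assms by (simp only: intertwines_rows_def)
    from arg_cong[OF this, of "\<lambda>z. t i * t (i - k) * z"]
    show "((\<chi> i j. t i * u $ i $ j) ** A) $ i $ a * (\<chi> i j. t i * u $ i $ j) $ (i - k) $ b
        = ((\<chi> i j. t i * u $ i $ j) ** A) $ i $ b * (\<chi> i j. t i * u $ i $ j) $ (i - k) $ a"
      by (simp add: row mult_ac)
  qed
qed

lemma intertwines_rows_limit:
  assumes "\<And>n. intertwines_rows k (u n) (A n)" "u \<longlonglongrightarrow> u'" "A \<longlonglongrightarrow> A'"
  shows "intertwines_rows k u' A'"
  unfolding intertwines_rows_def
proof (intro allI)
  fix i a b
  have lim: "(\<lambda>n. (u n ** A n) $ i $ a * u n $ (i - k) $ b) \<longlonglongrightarrow> (u' ** A') $ i $ a * u' $ (i - k) $ b"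
    for a b
    by (intro tendsto_mult tendsto_vec_nth tendsto_matrix_mult assms)
  show "(u' ** A') $ i $ a * u' $ (i - k) $ b = (u' ** A') $ i $ b * u' $ (i - k) $ a"
  proof (rule LIMSEQ_unique[OF lim[of a b]])
    have "(u n ** A n) $ i $ a * u n $ (i - k) $ b = (u n ** A n) $ i $ b * u n $ (i - k) $ a" for n
      using assms(1)[of n] by (simp only: intertwines_rows_def)
    then show "(\<lambda>n. (u n ** A n) $ i $ a * u n $ (i - k) $ b) \<longlonglongrightarrow> (u' ** A') $ i $ b * u' $ (i - k) $ a"
      using lim[of b a] by simp
  qed
qed

text \<open>Diagonal \<open>R x\<close> that separate the coordinates leave one nonzero entry, at \<open>f i\<close>, in row \<open>i\<close>. The
  relation for \<open>\<gamma>\<close> says that \<open>f\<close> commutes with the translation by \<open>\<kappa> \<gamma>\<close>, so \<open>f\<close> is itself a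
  translation. The rows of \<open>u\<close> are only assumed to be nonzero, so that the lemma applies to limits
  of invertible matrices; invertibility is part of the conclusion.\<close>

lemma intertwiner_monomial:
  fixes u :: "complex^('p::prime_card mod_ring)^('p mod_ring)"
  assumes R: "\<And>x. x \<in> S \<Longrightarrow> det (R x) \<noteq> 0 \<and> shift_shaped (\<kappa> x) (R x)"
    and sep: "\<And>i j. i \<noteq> j \<Longrightarrow> \<exists>x\<in>S. \<kappa> x = 0 \<and> R x $ i $ i \<noteq> R x $ j $ j"
    and \<gamma>: "\<gamma> \<in> S" "\<kappa> \<gamma> \<noteq> 0"
    and rows: "\<And>i. u $ i \<noteq> 0"
    and int: "\<And>x. x \<in> S \<Longrightarrow> intertwines_rows (\<kappa> x) u (R x)"
  shows "\<exists>l. shift_shaped l u \<and> det u \<noteq> 0"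
proof -
  have rel: "u $ i $ (a + \<kappa> x) * R x $ (a + \<kappa> x) $ a * u $ (i - \<kappa> x) $ b
      = u $ i $ (b + \<kappa> x) * R x $ (b + \<kappa> x) $ b * u $ (i - \<kappa> x) $ a" if x: "x \<in> S" for x i a b
  proof -
    have "(u ** R x) $ i $ a * u $ (i - \<kappa> x) $ b = (u ** R x) $ i $ b * u $ (i - \<kappa> x) $ a"
      using int[OF x] by (simp only: intertwines_rows_def)
    then show ?thesis by (simp add: mult_shift_shaped_nth[OF conjunct2[OF R[OF x]]])
  qed
  have single: "a = b" if "u $ i $ a \<noteq> 0" "u $ i $ b \<noteq> 0" for i a b
  proof (rule ccontr)
    assume "a \<noteq> b"
    then obtain x where x: "x \<in> S" "\<kappa> x = 0" "R x $ a $ a \<noteq> R x $ b $ b" using sep by blast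
    with rel[OF x(1), of i a b] that show False by simp
  qed
  have "\<exists>a. u $ i $ a \<noteq> 0" for i using rows[of i] by (auto simp: vec_eq_iff)
  then obtain f where f: "\<And>i. u $ i $ f i \<noteq> 0" by metis
  have step: "f (i + - \<kappa> \<gamma>) = f i + - \<kappa> \<gamma>" for i
  proof -
    have "R \<gamma> $ (f i - \<kappa> \<gamma> + \<kappa> \<gamma>) $ (f i - \<kappa> \<gamma>) \<noteq> 0"
      using R[OF \<gamma>(1)] shift_shaped_nonzero by blast
    then have "u $ (i - \<kappa> \<gamma>) $ (f i - \<kappa> \<gamma>) \<noteq> 0"
      using rel[OF \<gamma>(1), of i "f i - \<kappa> \<gamma>" "f (i - \<kappa> \<gamma>)"] f[of i] f[of "i - \<kappa> \<gamma>"] by auto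
    from single[OF this f] show ?thesis by simp
  qed
  have f0: "f i = i + f 0" for i
    by (rule mod_ring_translate_induct[of "- \<kappa> \<gamma>" _ 0]) (use \<gamma>(2) step in \<open>auto simp: algebra_simps\<close>)
  have f_inj: "f i = f b \<longleftrightarrow> i = b" for i b using f0[of i] f0[of b] by auto
  have shape: "shift_shaped (- f 0) u"
    unfolding shift_shaped_def
  proof (intro allI impI)
    fix i a assume "u $ i $ a \<noteq> 0"
    then have "a = f i" using single f by blast
    then show "i = a + - f 0" by (simp add: f0[of i])
  qed
  define w where "w = (\<chi> a b. if a = b + f 0 then 1 / u $ b $ a else 0)"
  have "u ** w = mat 1"
    unfolding vec_eq_iff shift_shaped_mult_nth[OF shape]
    using f f_inj by (auto simp: w_def mat_def f0[symmetric])
  then have "det u * det w = 1" by (simp add: det_mul[symmetric])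
  then have "det u \<noteq> 0" by auto
  with shape show ?thesis by blast
qed

section \<open>Properness of conjugation\<close>

lemma nonzero_rows:
  fixes A :: "complex^'n^'n"
  assumes "det A \<noteq> 0"
  shows "A $ i \<noteq> 0"
proof
  assume "A $ i = 0"
  then have "(A ** matrix_inv A) $ i $ i = 0" by (simp add: matrix_matrix_mult_def)
  then show False by (simp add: matrix_inv_det_nonzero[OF assms] mat_def)
qed

lemma conjugator_in_DM:
  fixes \<rho> :: "'g \<Rightarrow> (complex^('p::prime_card mod_ring)^('p mod_ring)) set"
  assumes "group \<Gamma>" and \<rho>: "\<rho> \<in> Homi_PSL \<Gamma>"
    and sh: "\<forall>x\<in>carrier \<Gamma>. psl_shift (\<kappa> x) (\<rho> x)"
    and \<gamma>: "\<gamma> \<in> carrier \<Gamma>" "\<kappa> \<gamma> \<noteq> 0"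
    and g: "g \<in> carrier PSL"
    and sh': "\<forall>x\<in>carrier \<Gamma>. psl_shift (\<kappa> x) (conjugate_rep \<Gamma> PSL g \<rho> x)"
  shows "g \<in> DM"
proof -
  have "\<forall>x\<in>carrier \<Gamma>. \<exists>A. det A = 1 \<and> \<rho> x = psl_proj A"
    using sh by (auto simp: psl_shift_def)
  then obtain R where R: "\<forall>x\<in>carrier \<Gamma>. det (R x) = 1 \<and> \<rho> x = psl_proj (R x)" by metis
  obtain G where G: "det G = 1" "g = psl_proj G" using g by (rule PSL_cases)
  have shR: "shift_shaped (\<kappa> x) (R x)" if "x \<in> carrier \<Gamma>" for x
    using psl_shift_lift[of "\<kappa> x" "R x"] bspec[OF sh that] bspec[OF R that] by simp
  have int: "intertwines_rows (\<kappa> x) G (R x)" if x: "x \<in> carrier \<Gamma>" for x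
  proof (rule intertwines_rowsI)
    let ?T = "G ** R x ** matrix_inv G"
    have T: "det ?T = 1" using G bspec[OF R x] by (simp add: det_conj)
    have "conjugate_rep \<Gamma> PSL g \<rho> x = psl_proj ?T"
      using x G bspec[OF R x]
      by (simp add: conjugate_rep_apply psl_proj_inv psl_proj_mult det_mul det_matrix_inv)
    with bspec[OF sh' x] T show "shift_shaped (\<kappa> x) ?T" by (simp add: psl_shift_lift)
    have "?T ** G = G ** R x ** (matrix_inv G ** G)" by (simp only: matrix_mul_assoc)
    then show "G ** R x = ?T ** G" using G by (simp add: matrix_inv_det_nonzero)
  qed
  have "\<exists>l. shift_shaped l G \<and> det G \<noteq> 0"
  proof (rule intertwiner_monomial[of "carrier \<Gamma>" R \<kappa> \<gamma>])
    show "det (R x) \<noteq> 0 \<and> shift_shaped (\<kappa> x) (R x)" if "x \<in> carrier \<Gamma>" for x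
      using shR[OF that] bspec[OF R that] by simp
    show "\<exists>x\<in>carrier \<Gamma>. \<kappa> x = 0 \<and> R x $ i $ i \<noteq> R x $ j $ j" if "i \<noteq> j" for i j
      using irreducible_separates[OF assms(1) \<rho> sh R \<gamma> that] .
    show "G $ i \<noteq> 0" for i using G by (intro nonzero_rows) simp
  qed (use \<gamma> int in auto)
  then obtain l where "shift_shaped l G" by blast
  then have "psl_shift l g" using G by (auto intro: psl_shiftI)
  then show ?thesis by (auto simp: DM_iff)
qed

text \<open>Matrices with unit rows form a compact set.\<close>

lemma normalized_rows_subsequence:
  fixes G :: "nat \<Rightarrow> complex^'n^'m"
  assumes rows: "\<And>n i. G n $ i \<noteq> 0"
  defines "u \<equiv> (\<lambda>n. \<chi> i j. of_real (inverse (norm (G n $ i))) * G n $ i $ j)"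
  shows "\<exists>\<phi> u'. strict_mono (\<phi> :: nat \<Rightarrow> nat) \<and> (\<lambda>n. u (\<phi> n)) \<longlonglongrightarrow> u' \<and> (\<forall>i. u' $ i \<noteq> 0)"
proof -
  have row: "u n $ i = inverse (norm (G n $ i)) *\<^sub>R (G n $ i)" for n i
    unfolding u_def by (simp add: vec_eq_iff) (simp add: scaleR_conv_of_real)
  have norm1: "norm (u n $ i) = 1" for n i
    using rows[of n i] by (simp add: row)
  have "norm (u n) \<le> real CARD('m)" for n
  proof -
    have "norm (u n) \<le> (\<Sum>i\<in>UNIV. norm (u n $ i))"
      unfolding norm_vec_def by (rule L2_set_le_sum) simp
    then show ?thesis by (simp add: norm1)
  qed
  then have "bounded (range u)" by (auto simp: bounded_iff)
  then obtain u' \<phi> where \<phi>: "strict_mono (\<phi> :: nat \<Rightarrow> nat)" "(u \<circ> \<phi>) \<longlonglongrightarrow> u'"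
    using bounded_imp_convergent_subsequence[of u] by blast
  then have lim: "(\<lambda>n. u (\<phi> n)) \<longlonglongrightarrow> u'" by (simp add: comp_def)
  have "norm (u' $ i) = 1" for i
  proof (rule LIMSEQ_unique[of "\<lambda>n. norm (u (\<phi> n) $ i)"])
    show "(\<lambda>n. norm (u (\<phi> n) $ i)) \<longlonglongrightarrow> norm (u' $ i)"
      by (intro tendsto_norm tendsto_vec_nth lim)
    show "(\<lambda>n. norm (u (\<phi> n) $ i)) \<longlonglongrightarrow> 1" by (simp add: norm1)
  qed
  then have "u' $ i \<noteq> 0" for i by (metis norm_zero zero_neq_one)
  with \<phi>(1) lim show ?thesis by blast
qed

text \<open>Properness of the conjugation action modulo \<open>DM\<close>. The correction \<open>k n\<close> is the class of the diagonal matrix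
  that normalizes the rows of a lift of \<open>g (\<phi> n)\<close>, and \<open>h\<close> is the class of the limit of
  the normalized matrices.\<close>

lemma conjugates_subconverge:
  fixes \<rho> :: "'g \<Rightarrow> (complex^('p::prime_card mod_ring)^('p mod_ring)) set"
  assumes "group \<Gamma>" and \<rho>: "\<rho> \<in> Homi_PSL \<Gamma>"
    and sh: "\<forall>x\<in>carrier \<Gamma>. psl_shift (\<kappa> x) (\<rho> x)"
    and \<gamma>: "\<gamma> \<in> carrier \<Gamma>" "\<kappa> \<gamma> \<noteq> 0"
    and conv: "\<forall>x\<in>carrier \<Gamma>. psl_tendsto (\<lambda>n. \<rho>s n x) (\<rho> x)"
    and g: "\<And>n. g n \<in> carrier PSL"
    and sh': "\<And>n. \<forall>x\<in>carrier \<Gamma>. psl_shift (\<kappa> x) (conjugate_rep \<Gamma> PSL (g n) (\<rho>s n) x)"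
  obtains \<phi> k h where "strict_mono (\<phi> :: nat \<Rightarrow> nat)" "\<And>n. k n \<in> DM" "h \<in> DM"
    "\<And>x. x \<in> carrier \<Gamma> \<Longrightarrow> psl_tendsto
       (\<lambda>n. conjugate_rep \<Gamma> PSL (k n) (conjugate_rep \<Gamma> PSL (g (\<phi> n)) (\<rho>s (\<phi> n))) x)
       (conjugate_rep \<Gamma> PSL h \<rho> x)"
proof -
  have "\<forall>x\<in>carrier \<Gamma>. \<exists>A B. (\<forall>n. det (A n) = 1 \<and> \<rho>s n x = psl_proj (A n)) \<and>
     det B = 1 \<and> \<rho> x = psl_proj B \<and> A \<longlonglongrightarrow> B"
    using conv unfolding psl_tendsto_def .
  then obtain A R where AR: "\<forall>x\<in>carrier \<Gamma>. (\<forall>n. det (A x n) = 1 \<and> \<rho>s n x = psl_proj (A x n)) \<and>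
     det (R x) = 1 \<and> \<rho> x = psl_proj (R x) \<and> A x \<longlonglongrightarrow> R x"
    by metis
  have A: "det (A x n) = 1" "\<rho>s n x = psl_proj (A x n)" if "x \<in> carrier \<Gamma>" for x n
    using bspec[OF AR that] by blast+
  have R: "\<forall>x\<in>carrier \<Gamma>. det (R x) = 1 \<and> \<rho> x = psl_proj (R x)" using AR by blast
  have lim: "A x \<longlonglongrightarrow> R x" if "x \<in> carrier \<Gamma>" for x using bspec[OF AR that] by blast
  have "\<forall>n. \<exists>G. det G = 1 \<and> g n = psl_proj G" using g by (metis PSL_cases)
  then obtain G where G: "\<And>n. det (G n) = 1" "\<And>n. g n = psl_proj (G n)" by metis
  define T where "T x n = G n ** A x n ** matrix_inv (G n)" for x n
  have detT: "det (T x n) = 1" if "x \<in> carrier \<Gamma>" for x n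
    using A(1)[OF that] G by (simp add: T_def det_conj)
  have \<tau>: "conjugate_rep \<Gamma> PSL (g n) (\<rho>s n) x = psl_proj (T x n)" if x: "x \<in> carrier \<Gamma>" for x n
    using x G A[OF x]
    by (simp add: conjugate_rep_apply psl_proj_inv psl_proj_mult det_mul det_matrix_inv T_def)
  have shT: "shift_shaped (\<kappa> x) (T x n)" if x: "x \<in> carrier \<Gamma>" for x n
    using bspec[OF sh'[of n] x] detT[OF x] by (simp add: \<tau>[OF x] psl_shift_lift)
  have TG: "T x n ** G n = G n ** A x n" for x n
  proof -
    have "T x n ** G n = G n ** A x n ** (matrix_inv (G n) ** G n)"
      by (simp only: T_def matrix_mul_assoc)
    then show ?thesis using G by (simp add: matrix_inv_det_nonzero)
  qed
  have rows: "G n $ i \<noteq> 0" for n i using G by (intro nonzero_rows) simp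
  define t where "t n i = complex_of_real (inverse (norm (G n $ i)))" for n i
  define u where "u n = (\<chi> i j. t n i * G n $ i $ j)" for n
  from normalized_rows_subsequence[of G, OF rows]
  obtain \<phi> u' where \<phi>: "strict_mono (\<phi> :: nat \<Rightarrow> nat)" and u'_lim: "(\<lambda>n. \<chi> i j. of_real (inverse (norm (G (\<phi> n) $ i)))
      * G (\<phi> n) $ i $ j) \<longlonglongrightarrow> u'" and u'_rows: "\<forall>i. u' $ i \<noteq> 0"
    by (elim exE conjE)
  have u': "(\<lambda>n. u (\<phi> n)) \<longlonglongrightarrow> u'" "\<And>i. u' $ i \<noteq> 0"
    using u'_lim u'_rows by (simp_all only: u_def t_def simp_thms)
  have int: "intertwines_rows (\<kappa> x) u' (R x)" if x: "x \<in> carrier \<Gamma>" for x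
  proof (rule intertwines_rows_limit)
    show "intertwines_rows (\<kappa> x) (u (\<phi> n)) (A x (\<phi> n))" for n
      unfolding u_def
      by (rule intertwines_rows_scale[OF intertwines_rowsI[OF shT[OF x] TG[symmetric]]])
    show "(\<lambda>n. A x (\<phi> n)) \<longlonglongrightarrow> R x"
      using LIMSEQ_subseq_LIMSEQ[OF lim[OF x] \<phi>] by (simp add: comp_def)
  qed (rule u')
  have "\<exists>l. shift_shaped l u' \<and> det u' \<noteq> 0"
  proof (rule intertwiner_monomial[of "carrier \<Gamma>" R \<kappa> \<gamma>])
    show "det (R x) \<noteq> 0 \<and> shift_shaped (\<kappa> x) (R x)" if "x \<in> carrier \<Gamma>" for x
      using psl_shift_lift[of "\<kappa> x" "R x"] bspec[OF sh that] bspec[OF R that] by simp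
    show "\<exists>x\<in>carrier \<Gamma>. \<kappa> x = 0 \<and> R x $ i $ i \<noteq> R x $ j $ j" if "i \<noteq> j" for i j
      using irreducible_separates[OF assms(1) \<rho> sh R \<gamma> that] .
  qed (use \<gamma> int u' in auto)
  then obtain l where l: "shift_shaped l u'" "det u' \<noteq> 0" by blast
  obtain c where c: "det (mat c ** u') = 1"
    "\<And>B. det B = 1 \<Longrightarrow> psl_proj (mat c ** u') \<otimes>\<^bsub>PSL\<^esub> psl_proj B \<otimes>\<^bsub>PSL\<^esub> inv\<^bsub>PSL\<^esub> (psl_proj (mat c ** u'))
       = psl_proj (u' ** B ** matrix_inv u')"
    by (rule psl_conj_GL[OF l(2)]) blast
  define h where "h = psl_proj (mat c ** u')"
  have h: "h \<in> DM"
    using psl_shiftI[OF c(1) shift_shaped_scale[OF l(1)]] by (auto simp: DM_iff h_def)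
  define D where "D n = (\<chi> i j. if i = j then t n i else 0)" for n
  have D_shape: "shift_shaped 0 (D n)" for n by (simp add: shift_shaped_def D_def)
  have "det (D n) = (\<Prod>i\<in>UNIV. D n $ i $ i)" for n by (rule det_diagonal) (simp add: D_def)
  then have D_det: "det (D n) \<noteq> 0" for n using rows by (simp add: D_def t_def)
  have uDG: "u n = D n ** G n" for n
    by (simp add: vec_eq_iff shift_shaped_mult_nth[OF D_shape]) (simp add: u_def D_def)
  have u_det: "det (u n) \<noteq> 0" for n using D_det G by (simp add: uDG det_mul)
  \<comment> \<open>Conjugating by the diagonal matrix after \<open>G n\<close> amounts to conjugating by \<open>u n\<close>, which converges.\<close>
  have conj: "D n ** T x n ** matrix_inv (D n) = u n ** A x n ** matrix_inv (u n)" for x n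
  proof -
    let ?X = "D n ** T x n ** matrix_inv (D n)"
    have "?X ** u n = D n ** T x n ** (matrix_inv (D n) ** D n) ** G n"
      by (simp only: uDG matrix_mul_assoc)
    also have "\<dots> = D n ** (T x n ** G n)"
      by (simp add: matrix_inv_det_nonzero[OF D_det] matrix_mul_assoc)
    also have "\<dots> = u n ** A x n" by (simp add: TG uDG matrix_mul_assoc)
    finally have "?X ** u n = u n ** A x n" .
    then have "?X ** (u n ** matrix_inv (u n)) = u n ** A x n ** matrix_inv (u n)"
      by (simp only: matrix_mul_assoc)
    then show ?thesis by (simp add: matrix_inv_det_nonzero[OF u_det])
  qed
  have "\<exists>k\<in>DM. \<forall>B. det B = 1 \<longrightarrow>
      k \<otimes>\<^bsub>PSL\<^esub> psl_proj B \<otimes>\<^bsub>PSL\<^esub> inv\<^bsub>PSL\<^esub> k = psl_proj (D n ** B ** matrix_inv (D n))" for n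
  proof -
    obtain d where d: "det (mat d ** D n) = 1"
      "\<And>B. det B = 1 \<Longrightarrow> psl_proj (mat d ** D n) \<otimes>\<^bsub>PSL\<^esub> psl_proj B \<otimes>\<^bsub>PSL\<^esub> inv\<^bsub>PSL\<^esub> (psl_proj (mat d ** D n))
         = psl_proj (D n ** B ** matrix_inv (D n))"
      by (rule psl_conj_GL[OF D_det[of n]]) blast
    have "psl_proj (mat d ** D n) \<in> DM"
      using psl_shiftI[OF d(1) shift_shaped_scale[OF D_shape]] by (auto simp: DM_iff)
    with d(2) show ?thesis by blast
  qed
  then obtain k where k: "\<And>n. k n \<in> DM"
    "\<And>n B. det B = 1 \<Longrightarrow> k n \<otimes>\<^bsub>PSL\<^esub> psl_proj B \<otimes>\<^bsub>PSL\<^esub> inv\<^bsub>PSL\<^esub> (k n)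
      = psl_proj (D n ** B ** matrix_inv (D n))"
    by metis
  show thesis
  proof (rule that[of \<phi> "\<lambda>n. k (\<phi> n)" h])
    fix x assume x: "x \<in> carrier \<Gamma>"
    show "psl_tendsto
       (\<lambda>n. conjugate_rep \<Gamma> PSL (k (\<phi> n)) (conjugate_rep \<Gamma> PSL (g (\<phi> n)) (\<rho>s (\<phi> n))) x)
       (conjugate_rep \<Gamma> PSL h \<rho> x)"
    proof (rule psl_tendstoI)
      let ?A = "\<lambda>n. u (\<phi> n) ** A x (\<phi> n) ** matrix_inv (u (\<phi> n))"
      let ?B = "u' ** R x ** matrix_inv u'"
      show "det (?A n) = 1" for n using A(1)[OF x] by (simp add: det_conj[OF u_det])
      show "det ?B = 1" using bspec[OF R x] by (simp add: det_conj[OF l(2)])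
      show "conjugate_rep \<Gamma> PSL (k (\<phi> n)) (conjugate_rep \<Gamma> PSL (g (\<phi> n)) (\<rho>s (\<phi> n))) x = psl_proj (?A n)" for n
        using k(2)[OF detT[OF x], of "\<phi> n" "\<phi> n"]
        by (simp only: conjugate_rep_apply[OF x, where g = "k (\<phi> n)"] \<tau>[OF x] conj)
      show "conjugate_rep \<Gamma> PSL h \<rho> x = psl_proj ?B"
        using c(2)[of "R x"] bspec[OF R x] by (simp add: conjugate_rep_apply[OF x] h_def)
      have "(\<lambda>n. A x (\<phi> n)) \<longlonglongrightarrow> R x"
        using LIMSEQ_subseq_LIMSEQ[OF lim[OF x] \<phi>] by (simp add: comp_def)
      then show "?A \<longlonglongrightarrow> ?B"
        by (intro tendsto_matrix_mult tendsto_matrix_inv u' l(2) u_det)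
    qed
  qed (use \<phi> k h in auto)
qed

section \<open>The homeomorphism\<close>

lemma Homi_PSL_subset: "Homi_PSL \<Gamma> \<subseteq> Hom \<Gamma> PSL"
  by (auto simp: Homi_PSL_def)

lemma topspace_Hom_top:
  fixes s :: "nat \<Rightarrow> 'g"
  assumes "s ` {..<r} \<subseteq> carrier \<Gamma>"
  shows "topspace (Hom_top \<Gamma> PSL PSL_top r s) = Hom \<Gamma> (PSL :: (complex^'n^'n) set monoid)"
proof -
  have "(\<lambda>i\<in>{..<r}. \<rho> (s i)) \<in> topspace (product_topology (\<lambda>_. PSL_top) {..<r})"
    if "\<rho> \<in> Hom \<Gamma> (PSL :: (complex^'n^'n) set monoid)" for \<rho>
    using assms Hom_carrier[OF that] by (auto simp: topspace_PSL_top)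
  then show ?thesis unfolding Hom_top_def topspace_pullback_topology by blast
qed

lemma chii_DM_eq:
  fixes \<Gamma> :: "('g, 'm) monoid_scheme"
  assumes "s ` {..<r} \<subseteq> carrier \<Gamma>"
  shows "(chii_DM \<Gamma> r s :: ('g \<Rightarrow> (complex^('p::prime_card mod_ring)^('p mod_ring)) set) set topology)
    = quotient_topology (subtopology (Hom_top \<Gamma> PSL PSL_top r s) (Homi_DM \<Gamma>)) (conj_class \<Gamma> PSL DM)"
proof -
  have "{\<rho>. \<rho> ` carrier \<Gamma> \<subseteq> DM} \<inter> Homi_DM \<Gamma> 
      = (Homi_DM \<Gamma> :: ('g \<Rightarrow> (complex^('p::prime_card mod_ring)^('p mod_ring)) set) set)"
    by (auto simp: Homi_DM_def)
  then show ?thesis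
    unfolding chii_DM_def
      Hom_top_subgroup[OF assms subgroup.subset[OF subgroup_DM]] subtopology_subtopology
    by simp
qed

text \<open>The quotient map by conjugation is open, as for every action by homeomorphisms.\<close>

lemma openin_conj_saturation:
  fixes Q :: "('g \<Rightarrow> (complex^'n^'n) set) set"
  assumes "group \<Gamma>" and s: "s ` {..<r} \<subseteq> carrier \<Gamma>"
    and Q: "openin (subtopology (Hom_top \<Gamma> PSL PSL_top r s) (Homi_PSL \<Gamma>)) Q"
  shows "openin (chii_PSL \<Gamma> r s) (conj_class \<Gamma> PSL (carrier PSL) ` Q)"
proof -
  interpret P: group "PSL :: (complex^'n^'n) set monoid" by (rule group_PSL)
  let ?T = "Hom_top \<Gamma> PSL PSL_top r s :: ('g \<Rightarrow> (complex^'n^'n) set) topology"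
  let ?X = "Homi_PSL \<Gamma> :: ('g \<Rightarrow> (complex^'n^'n) set) set"
  let ?\<pi> = "conj_class \<Gamma> PSL (carrier PSL) :: ('g \<Rightarrow> (complex^'n^'n) set) \<Rightarrow> _"
  have top: "topspace (subtopology ?T ?X) = ?X"
    using Homi_PSL_subset by (auto simp: topspace_Hom_top[OF s])
  have QX: "Q \<subseteq> ?X" using openin_subset[OF Q] by (simp only: top)
  obtain W where W: "openin ?T W" "Q = W \<inter> ?X" using Q by (auto simp: openin_subtopology)
  have "openin (subtopology ?T ?X) {\<rho> \<in> ?X. ?\<pi> \<rho> \<in> ?\<pi> ` Q}"
  proof (rule openin_Hom_sequentially[OF s Homi_PSL_subset])
    fix \<rho>s \<rho>
    assume \<rho>s: "\<And>n. \<rho>s n \<in> ?X" and \<rho>: "\<rho> \<in> {\<rho> \<in> ?X. ?\<pi> \<rho> \<in> ?\<pi> ` Q}"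
      and conv: "\<And>x. x \<in> s ` {..<r} \<Longrightarrow> psl_tendsto (\<lambda>n. \<rho>s n x) (\<rho> x)"
    from \<rho> obtain \<sigma> where \<sigma>: "\<sigma> \<in> Q" "?\<pi> \<rho> = ?\<pi> \<sigma>" by auto
    have \<rho>H: "\<rho> \<in> Hom \<Gamma> PSL" "\<sigma> \<in> Hom \<Gamma> PSL" using \<rho> \<sigma> QX Homi_PSL_subset by blast+
    have \<rho>sH: "\<rho>s n \<in> Hom \<Gamma> PSL" for n using \<rho>s Homi_PSL_subset by blast
    obtain g where g: "g \<in> carrier PSL" "\<sigma> = conjugate_rep \<Gamma> PSL g \<rho>"
      using \<sigma>(2) P.conj_class_eq_iff[OF P.subgroup_self \<rho>H] by blast
    have conjX: "conjugate_rep \<Gamma> PSL g (\<rho>s n) \<in> ?X" for n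
      by (rule conjugate_rep_Homi[OF assms(1) \<rho>s g(1)])
    have "\<forall>\<^sub>F n in sequentially. conjugate_rep \<Gamma> PSL g (\<rho>s n) \<in> W"
    proof (rule eventually_in_open_Hom[OF s W(1)])
      show "\<sigma> \<in> W" using \<sigma>(1) W(2) by blast
      show "conjugate_rep \<Gamma> PSL g (\<rho>s n) \<in> Hom \<Gamma> PSL" for n
        using conjX Homi_PSL_subset by blast
      fix x assume x: "x \<in> s ` {..<r}"
      then have "x \<in> carrier \<Gamma>" using s by blast
      then show "psl_tendsto (\<lambda>n. conjugate_rep \<Gamma> PSL g (\<rho>s n) x) (\<sigma> x)"
        using psl_tendsto_conj[OF g(1) conv[OF x]] by (simp add: g(2) conjugate_rep_apply)
    qed
    then show "\<forall>\<^sub>F n in sequentially. \<rho>s n \<in> {\<rho> \<in> ?X. ?\<pi> \<rho> \<in> ?\<pi> ` Q}"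
    proof eventually_elim
      case (elim n)
      then have "conjugate_rep \<Gamma> PSL g (\<rho>s n) \<in> Q" using conjX W(2) by blast
      moreover have "?\<pi> (\<rho>s n) = ?\<pi> (conjugate_rep \<Gamma> PSL g (\<rho>s n))"
        using P.conj_class_eq_iff[OF P.subgroup_self \<rho>sH P.conjugate_rep_Hom[OF assms(1) \<rho>sH g(1)]] g(1)
        by blast
      ultimately show ?case using \<rho>s by simp
    qed
  qed auto
  then show ?thesis
    unfolding chii_PSL_def openin_quotient_topology top using QX by blast
qed

theorem theorem2:
  fixes \<Gamma> :: "('g, 'm) monoid_scheme" and r :: nat and s :: "nat \<Rightarrow> 'g"
    and \<rho>bar :: "'g \<Rightarrow> (complex^('p::prime_card mod_ring)^('p mod_ring)) set"
  assumes "group \<Gamma>"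
    and "s ` {..<r} \<subseteq> carrier \<Gamma>" and "generate \<Gamma> (s ` {..<r}) = carrier \<Gamma>"
    and "\<rho>bar \<in> Hom \<Gamma> (PSL\<lparr>carrier := cyc\<rparr>)"
    and "\<exists>x\<in>carrier \<Gamma>. \<rho>bar x \<noteq> \<one>\<^bsub>PSL\<^esub>"
  shows "homeomorphic_map
           (subtopology (chii_DM \<Gamma> r s) (H_class \<Gamma> \<rho>bar))
           (subtopology (chii_PSL \<Gamma> r s) (phi \<Gamma> ` H_class \<Gamma> \<rho>bar))
           (phi \<Gamma>)"
proof -
  interpret P: group "PSL :: (complex^('p mod_ring)^('p mod_ring)) set monoid" by (rule group_PSL)
  let ?T = "Hom_top \<Gamma> PSL PSL_top r s :: ('g \<Rightarrow> (complex^('p mod_ring)^('p mod_ring)) set) topology"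
  let ?X = "Homi_PSL \<Gamma> :: ('g \<Rightarrow> (complex^('p mod_ring)^('p mod_ring)) set) set"
  let ?Y = "Homi_DM \<Gamma> :: ('g \<Rightarrow> (complex^('p mod_ring)^('p mod_ring)) set) set"
  let ?\<pi>P = "conj_class \<Gamma> PSL (carrier PSL) :: ('g \<Rightarrow> (complex^('p mod_ring)^('p mod_ring)) set) \<Rightarrow> _"
  let ?\<pi>D = "conj_class \<Gamma> PSL DM :: ('g \<Rightarrow> (complex^('p mod_ring)^('p mod_ring)) set) \<Rightarrow> _"
  let ?H = "H_rep \<Gamma> \<rho>bar"
  note s = assms(2)
  have YX: "?Y \<subseteq> ?X" by (auto simp: Homi_DM_def)
  have XH: "?X \<subseteq> Hom \<Gamma> PSL" by (rule Homi_PSL_subset)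
  have HY: "?H \<subseteq> ?Y" by (auto simp: H_rep_def)
  have topX: "topspace (subtopology ?T ?X) = ?X" and topY: "topspace (subtopology ?T ?Y) = ?Y"
    using XH YX by (auto simp: topspace_Hom_top[OF s])
  have DM_PSL: "g \<in> carrier PSL" if "g \<in> DM" for g :: "(complex^('p mod_ring)^('p mod_ring)) set"
    using subgroup.mem_carrier[OF subgroup_DM that] .
  have \<pi>D_eq: "?\<pi>D (conjugate_rep \<Gamma> PSL k \<rho>) = ?\<pi>D \<rho>" if "\<rho> \<in> Hom \<Gamma> PSL" "k \<in> DM" for \<rho> k
    using P.conj_class_eq_iff[OF subgroup_DM that(1) P.conjugate_rep_Hom[OF assms(1) that(1) DM_PSL[OF that(2)]]]
      that(2) by blast

  \<comment> \<open>\<open>\<kappa> x\<close> is the exponent of \<open>M_c\<close> in \<open>\<rho>bar x\<close>.\<close>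
  have "\<forall>x\<in>carrier \<Gamma>. \<exists>k. \<rho>bar x \<in> cyc \<and> psl_shift k (\<rho>bar x)"
    using Hom_carrier[OF assms(4)] cyc_psl_shift by auto
  then obtain \<kappa> where \<kappa>: "\<forall>x\<in>carrier \<Gamma>. \<rho>bar x \<in> cyc \<and> psl_shift (\<kappa> x) (\<rho>bar x)" by metis
  have H_iff: "\<rho> \<in> ?H \<longleftrightarrow> \<rho> \<in> ?X \<and> (\<forall>x\<in>carrier \<Gamma>. psl_shift (\<kappa> x) (\<rho> x))" for \<rho>
    by (rule H_rep_iff) (use \<kappa> in blast)
  obtain \<gamma> where \<gamma>: "\<gamma> \<in> carrier \<Gamma>" "\<rho>bar \<gamma> \<noteq> \<one>\<^bsub>PSL\<^esub>" using assms(5) by blast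
  have \<kappa>\<gamma>: "\<kappa> \<gamma> \<noteq> 0"
  proof
    assume "\<kappa> \<gamma> = 0"
    then have "psl_shift 0 (\<rho>bar \<gamma>)" "\<rho>bar \<gamma> \<in> cyc" using bspec[OF \<kappa> \<gamma>(1)] by auto
    moreover have "\<one>\<^bsub>PSL\<^esub> \<in> cyc" unfolding cyc_def by (rule generate.one)
    ultimately have "\<rho>bar \<gamma> = \<one>\<^bsub>PSL\<^esub>" by (intro cyc_psl_shift_inj[of _ _ 0] psl_shift_one)
    with \<gamma>(2) show False ..
  qed
  have conjH: "conjugate_rep \<Gamma> PSL k \<rho> \<in> ?H" if \<rho>: "\<rho> \<in> ?H" and k: "k \<in> DM" for \<rho> k
  proof -
    obtain l where l: "psl_shift l k" using k by (auto simp: DM_iff)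
    show ?thesis
      using \<rho> psl_shift_conj[OF l] conjugate_rep_Homi[OF assms(1) _ DM_PSL[OF k], of \<rho>]
      by (simp add: H_iff conjugate_rep_apply)
  qed

  have phi: "phi \<Gamma> (?\<pi>D \<rho>) = ?\<pi>P \<rho>" if "\<rho> \<in> Hom \<Gamma> PSL" for \<rho>
    using that by (rule phi_conj_class)
  have qD: "quotient_map (subtopology ?T ?Y) (chii_DM \<Gamma> r s) ?\<pi>D"
    unfolding chii_DM_eq[OF s] by (rule quotient_map_quotient_topology)
  have qP: "quotient_map (subtopology ?T ?X) (chii_PSL \<Gamma> r s) ?\<pi>P"
    unfolding chii_PSL_def by (rule quotient_map_quotient_topology)
  have top_DM: "topspace (chii_DM \<Gamma> r s) = ?\<pi>D ` ?Y"
    using quotient_imp_surjective_map[OF qD] by (simp only: topY)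
  have top_PSL: "topspace (chii_PSL \<Gamma> r s) = ?\<pi>P ` ?X"
    using quotient_imp_surjective_map[OF qP] by (simp only: topX)
  have H_class_sub: "H_class \<Gamma> \<rho>bar \<subseteq> topspace (chii_DM \<Gamma> r s)"
    unfolding top_DM H_class_def using HY by blast
  have phi_class: "phi \<Gamma> ` H_class \<Gamma> \<rho>bar = ?\<pi>P ` ?H"
    unfolding H_class_def image_image using HY YX XH phi by (intro image_cong refl) blast
  have phi_sub: "phi \<Gamma> ` H_class \<Gamma> \<rho>bar \<subseteq> topspace (chii_PSL \<Gamma> r s)"
    unfolding phi_class top_PSL using HY YX by blast

  have "continuous_map (subtopology ?T ?Y) (chii_PSL \<Gamma> r s) ?\<pi>P"
    using quotient_imp_continuous_map[OF qP] YX by (rule continuous_map_from_subtopology_mono)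
  then have "continuous_map (subtopology ?T ?Y) (chii_PSL \<Gamma> r s) (phi \<Gamma> \<circ> ?\<pi>D)"
    by (rule continuous_map_eq) (use topY YX XH phi in auto)
  then have "continuous_map (chii_DM \<Gamma> r s) (chii_PSL \<Gamma> r s)
      (phi \<Gamma> :: _ \<Rightarrow> ('g \<Rightarrow> (complex^('p mod_ring)^('p mod_ring)) set) set)"
    by (rule continuous_compose_quotient_map[OF qD])
  then have cont: "continuous_map (subtopology (chii_DM \<Gamma> r s) (H_class \<Gamma> \<rho>bar))
      (subtopology (chii_PSL \<Gamma> r s) (phi \<Gamma> ` H_class \<Gamma> \<rho>bar)) (phi \<Gamma>)"
    by (auto simp: continuous_map_in_subtopology continuous_map_from_subtopology)

  have inj: "inj_on (phi \<Gamma>) (H_class \<Gamma> \<rho>bar)"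
  proof (rule inj_onI)
    fix c d assume "c \<in> H_class \<Gamma> \<rho>bar" "d \<in> H_class \<Gamma> \<rho>bar" and eq: "phi \<Gamma> c = phi \<Gamma> d"
    then obtain \<rho> \<sigma> where \<rho>: "\<rho> \<in> ?H" "c = ?\<pi>D \<rho>" and \<sigma>: "\<sigma> \<in> ?H" "d = ?\<pi>D \<sigma>"
      by (auto simp: H_class_def)
    have hom: "\<rho> \<in> Hom \<Gamma> PSL" "\<sigma> \<in> Hom \<Gamma> PSL" using \<rho> \<sigma> HY YX XH by blast+
    have "?\<pi>P \<rho> = ?\<pi>P \<sigma>" using eq by (simp add: \<rho>(2) \<sigma>(2) phi hom)
    then obtain g where g: "g \<in> carrier PSL" "\<sigma> = conjugate_rep \<Gamma> PSL g \<rho>"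
      using P.conj_class_eq_iff[OF P.subgroup_self hom] by blast
    have "g \<in> DM"
    proof (rule conjugator_in_DM[where \<kappa> = \<kappa>, OF assms(1) _ _ \<gamma>(1) \<kappa>\<gamma> g(1)])
      show "\<rho> \<in> ?X" "\<forall>x\<in>carrier \<Gamma>. psl_shift (\<kappa> x) (\<rho> x)"
        using \<rho>(1) H_iff by blast+
      show "\<forall>x\<in>carrier \<Gamma>. psl_shift (\<kappa> x) (conjugate_rep \<Gamma> PSL g \<rho> x)"
        using \<sigma>(1) H_iff unfolding g(2) by blast
    qed
    then show "c = d" using \<pi>D_eq[OF hom(1)] by (simp add: \<rho>(2) \<sigma>(2) g(2))
  qed

  have op: "open_map (subtopology (chii_DM \<Gamma> r s) (H_class \<Gamma> \<rho>bar))
      (subtopology (chii_PSL \<Gamma> r s) (phi \<Gamma> ` H_class \<Gamma> \<rho>bar)) (phi \<Gamma>)"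
    unfolding open_map_def
  proof (intro allI impI)
    fix U assume "openin (subtopology (chii_DM \<Gamma> r s) (H_class \<Gamma> \<rho>bar)) U"
    then obtain V where V: "openin (chii_DM \<Gamma> r s) V" "U = V \<inter> H_class \<Gamma> \<rho>bar"
      by (auto simp: openin_subtopology)
    have "openin (subtopology ?T ?Y) {\<rho> \<in> ?Y. ?\<pi>D \<rho> \<in> V}"
      using V(1) unfolding chii_DM_eq[OF s] openin_quotient_topology topY by blast
    then obtain W where W: "openin ?T W" "{\<rho> \<in> ?Y. ?\<pi>D \<rho> \<in> V} = W \<inter> ?Y"
      by (auto simp: openin_subtopology)
    \<comment> \<open>Conjugates of members of \<open>H_rep \<Gamma> \<rho>bar\<close> whose class lies outside \<open>V\<close>; properness keeps them away
      from the \<open>\<rho>\<close> whose class lies in \<open>V\<close>.\<close>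
    define Bad where "Bad = {\<rho> \<in> ?X. \<exists>g\<in>carrier PSL.
      conjugate_rep \<Gamma> PSL g \<rho> \<in> ?H \<and> ?\<pi>D (conjugate_rep \<Gamma> PSL g \<rho>) \<notin> V}"
    have nhd: "\<exists>N. openin ?T N \<and> \<rho> \<in> N \<and> N \<inter> ?X \<subseteq> - Bad" if \<rho>: "\<rho> \<in> ?H" "?\<pi>D \<rho> \<in> V" for \<rho>
    proof (rule Hom_nhd_sequentially[OF s])
      show \<rho>H: "\<rho> \<in> Hom \<Gamma> PSL" using \<rho> HY YX XH by blast
      have \<rho>X: "\<rho> \<in> ?X" and \<rho>sh: "\<forall>x\<in>carrier \<Gamma>. psl_shift (\<kappa> x) (\<rho> x)"
        using \<rho>(1) H_iff by blast+
      fix \<rho>s assume \<rho>s: "\<And>n. \<rho>s n \<in> ?X"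
        and conv: "\<And>x. x \<in> s ` {..<r} \<Longrightarrow> psl_tendsto (\<lambda>n. \<rho>s n x) (\<rho> x)"
      have \<rho>sH: "\<rho>s n \<in> Hom \<Gamma> PSL" for n using \<rho>s XH by blast
      show "\<forall>\<^sub>F n in sequentially. \<rho>s n \<in> - Bad"
      proof (rule ccontr)
        assume "\<not> ?thesis"
        then obtain \<psi> where \<psi>: "strict_mono (\<psi> :: nat \<Rightarrow> nat)" "\<And>n. \<rho>s (\<psi> n) \<in> Bad"
          using not_eventually_sequentiallyD by blast
        have "\<forall>n. \<exists>g\<in>carrier PSL. conjugate_rep \<Gamma> PSL g (\<rho>s (\<psi> n)) \<in> ?H
            \<and> ?\<pi>D (conjugate_rep \<Gamma> PSL g (\<rho>s (\<psi> n))) \<notin> V"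
          using \<psi>(2) by (auto simp: Bad_def)
        then obtain g where g: "\<And>n. g n \<in> carrier PSL"
          "\<And>n. conjugate_rep \<Gamma> PSL (g n) (\<rho>s (\<psi> n)) \<in> ?H"
          "\<And>n. ?\<pi>D (conjugate_rep \<Gamma> PSL (g n) (\<rho>s (\<psi> n))) \<notin> V"
          by metis
        have conv_all: "\<forall>x\<in>carrier \<Gamma>. psl_tendsto (\<lambda>n. \<rho>s (\<psi> n) x) (\<rho> x)"
        proof
          fix x assume "x \<in> carrier \<Gamma>"
          then have "x \<in> generate \<Gamma> (s ` {..<r})" by (simp only: assms(3))
          then have "psl_tendsto (\<lambda>n. \<rho>s n x) (\<rho> x)"
            by (rule psl_tendsto_generate[OF assms(1) s \<rho>sH \<rho>H, rotated]) (rule conv)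
          then show "psl_tendsto (\<lambda>n. \<rho>s (\<psi> n) x) (\<rho> x)" using \<psi>(1) by (rule psl_tendsto_subseq)
        qed
        have sh: "\<forall>x\<in>carrier \<Gamma>. psl_shift (\<kappa> x) (conjugate_rep \<Gamma> PSL (g n) (\<rho>s (\<psi> n)) x)" for n
          using g(2) H_iff by blast
        obtain \<phi> k h where \<phi>: "strict_mono (\<phi> :: nat \<Rightarrow> nat)" "\<And>n. k n \<in> DM" "h \<in> DM"
          and lim: "\<And>x. x \<in> carrier \<Gamma> \<Longrightarrow> psl_tendsto
            (\<lambda>n. conjugate_rep \<Gamma> PSL (k n) (conjugate_rep \<Gamma> PSL (g (\<phi> n)) (\<rho>s (\<psi> (\<phi> n)))) x)
            (conjugate_rep \<Gamma> PSL h \<rho> x)"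
          using conjugates_subconverge[OF assms(1) \<rho>X \<rho>sh \<gamma>(1) \<kappa>\<gamma> conv_all g(1) sh] by blast
        define \<tau> where "\<tau> n = conjugate_rep \<Gamma> PSL (g (\<phi> n)) (\<rho>s (\<psi> (\<phi> n)))" for n
        have \<tau>: "\<tau> n \<in> ?H" "?\<pi>D (\<tau> n) \<notin> V" for n using g by (simp_all add: \<tau>_def)
        have \<tau>H: "\<tau> n \<in> Hom \<Gamma> PSL" for n using \<tau>(1) HY YX XH by blast
        have kH: "conjugate_rep \<Gamma> PSL (k n) (\<tau> n) \<in> ?H" for n using conjH[OF \<tau>(1) \<phi>(2)] .
        have "conjugate_rep \<Gamma> PSL h \<rho> \<in> {\<rho> \<in> ?Y. ?\<pi>D \<rho> \<in> V}"
          using conjH[OF \<rho>(1) \<phi>(3)] HY \<pi>D_eq[OF \<rho>H \<phi>(3)] \<rho>(2) by auto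
        then have hW: "conjugate_rep \<Gamma> PSL h \<rho> \<in> W" using W(2) by blast
        have "\<forall>\<^sub>F n in sequentially. conjugate_rep \<Gamma> PSL (k n) (\<tau> n) \<in> W"
        proof (rule eventually_in_open_Hom[OF s W(1) hW])
          show "conjugate_rep \<Gamma> PSL (k n) (\<tau> n) \<in> Hom \<Gamma> PSL" for n
            using kH HY YX XH by blast
          fix x assume "x \<in> s ` {..<r}"
          then have "x \<in> carrier \<Gamma>" using s by blast
          from lim[OF this] show "psl_tendsto (\<lambda>n. conjugate_rep \<Gamma> PSL (k n) (\<tau> n) x)
              (conjugate_rep \<Gamma> PSL h \<rho> x)" unfolding \<tau>_def .
        qed
        then obtain n where "conjugate_rep \<Gamma> PSL (k n) (\<tau> n) \<in> W"
          using eventually_happens[of _ sequentially] by auto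
        then have "conjugate_rep \<Gamma> PSL (k n) (\<tau> n) \<in> {\<rho> \<in> ?Y. ?\<pi>D \<rho> \<in> V}"
          using kH HY W(2) by blast
        then show False using \<tau>(2)[of n] \<pi>D_eq[OF \<tau>H \<phi>(2)] by simp
      qed
    qed
    define Q where "Q = \<Union>{N. openin (subtopology ?T ?X) N \<and> N \<subseteq> - Bad}"
    have Q: "openin (subtopology ?T ?X) Q" unfolding Q_def by (rule openin_Union) blast
    have QBad: "Q \<subseteq> - Bad" unfolding Q_def by blast
    have QX: "Q \<subseteq> ?X" using openin_subset[OF Q] by (simp only: topX)
    have in_Q: "\<rho> \<in> Q" if \<rho>: "\<rho> \<in> ?H" "?\<pi>D \<rho> \<in> V" for \<rho>
    proof -
      obtain N where N: "openin ?T N" "\<rho> \<in> N" "N \<inter> ?X \<subseteq> - Bad" using nhd[OF \<rho>] by blast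
      then have "openin (subtopology ?T ?X) (N \<inter> ?X)" by (auto simp only: openin_subtopology)
      moreover have "\<rho> \<in> N \<inter> ?X" using N(2) \<rho>(1) HY YX by blast
      ultimately show ?thesis using N(3) unfolding Q_def by blast
    qed
    have "phi \<Gamma> ` U = ?\<pi>P ` Q \<inter> phi \<Gamma> ` H_class \<Gamma> \<rho>bar"
    proof (intro equalityI subsetI)
      fix c assume "c \<in> phi \<Gamma> ` U"
      then obtain \<rho> where \<rho>: "\<rho> \<in> ?H" "?\<pi>D \<rho> \<in> V" "c = phi \<Gamma> (?\<pi>D \<rho>)"
        using V(2) by (auto simp: H_class_def)
      moreover have "c = ?\<pi>P \<rho>" using \<rho> HY YX XH phi by blast
      ultimately show "c \<in> ?\<pi>P ` Q \<inter> phi \<Gamma> ` H_class \<Gamma> \<rho>bar"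
        using in_Q unfolding phi_class by blast
    next
      fix c assume "c \<in> ?\<pi>P ` Q \<inter> phi \<Gamma> ` H_class \<Gamma> \<rho>bar"
      then obtain \<rho> \<sigma> where \<rho>: "\<rho> \<in> Q" "c = ?\<pi>P \<rho>" and \<sigma>: "\<sigma> \<in> ?H" "c = ?\<pi>P \<sigma>"
        unfolding phi_class by blast
      have hom: "\<rho> \<in> Hom \<Gamma> PSL" "\<sigma> \<in> Hom \<Gamma> PSL" using \<rho> \<sigma> QX HY YX XH by blast+
      have "?\<pi>P \<rho> = ?\<pi>P \<sigma>" using \<rho>(2) \<sigma>(2) by simp
      then obtain g where g: "g \<in> carrier PSL" "\<sigma> = conjugate_rep \<Gamma> PSL g \<rho>"
        using P.conj_class_eq_iff[OF P.subgroup_self hom] by blast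
      have "\<rho> \<notin> Bad" "\<rho> \<in> ?X" using \<rho>(1) QBad QX by blast+
      then have "?\<pi>D \<sigma> \<in> V" using g \<sigma>(1) unfolding Bad_def by blast
      then have "?\<pi>D \<sigma> \<in> U" using \<sigma>(1) V(2) by (simp add: H_class_def)
      moreover have "c = phi \<Gamma> (?\<pi>D \<sigma>)" using phi[OF hom(2)] \<sigma>(2) by simp
      ultimately show "c \<in> phi \<Gamma> ` U" by blast
    qed
    moreover have "openin (chii_PSL \<Gamma> r s) (?\<pi>P ` Q)"
      by (rule openin_conj_saturation[OF assms(1) s Q])
    ultimately show "openin (subtopology (chii_PSL \<Gamma> r s) (phi \<Gamma> ` H_class \<Gamma> \<rho>bar)) (phi \<Gamma> ` U)"
      by (auto simp only: openin_subtopology)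
  qed

  show ?thesis
  proof (rule bijective_open_imp_homeomorphic_map[OF cont op])
    show "phi \<Gamma> ` topspace (subtopology (chii_DM \<Gamma> r s) (H_class \<Gamma> \<rho>bar))
        = topspace (subtopology (chii_PSL \<Gamma> r s) (phi \<Gamma> ` H_class \<Gamma> \<rho>bar))"
      using H_class_sub phi_sub by (simp add: Int_absorb1)
    show "inj_on (phi \<Gamma>) (topspace (subtopology (chii_DM \<Gamma> r s) (H_class \<Gamma> \<rho>bar)))"
      using inj by (rule inj_on_subset) auto
  qed
qed

end
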